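(* Let $p\in\{1,2\}$ and let $\Sigma$ be a $p$-dimensional $C^{1,1}$ submanifold of degree $d$ in the Engel group $\mathbb{E}$. Then for every $x\in\Sigma$ with $d_\Sigma(x)<d$ there holds $$\lim_{r\to0^+}\frac{\mu_p(\Sigma\cap D_{x,r})}{r^d}=+\infty .$$
   Context: Engel group: $\mathbb{E}=\mathbb{R}^4$ with the Lie group structure having identity $0$ for which the vector fields $X_1=\partial_1$, $X_2=\partial_2+x_1\partial_3+\frac{x_1^2}{2}\partial_4$, $X_3=\partial_3+x_1\partial_4$, $X_4=\partial_4$ form a basis of the left invariant vector fields (the only nontrivial brackets are $[X_1,X_2]=X_3$ and $[X_1,X_3]=X_4$). The dilations $\delta_r(x)=(rx_1,rx_2,r^2x_3,r^3x_4)$, $r>0$, are group automorphisms. Fix the left invariant Riemannian metric making $X_1,\dots,X_4$ orthonormal. Fix an arbitrary homogeneous distance $\rho$ on $\mathbb{R}^4$, that is, a continuous, left invariant distance with $\rho(\delta_rx,\delta_ry)=r\,\rho(x,y)$ for all $x,y\in\mathbb{R}^4$ and $r>0$ (for instance the Carnot-Carath\'eodory distance associated with $\mathrm{span}\{X_1,X_2\}$). $D_{x,r}$ is the closed $\rho$-ball of center $x$ and radius $r$. $\mu_p$ is the $p$-dimensional Riemannian surface measure induced on $\Sigma$ by the fixed left invariant metric. Submanifolds are embedded, without boundary; $C^{1,1}$ means locally parametrized by $C^1$ immersions with locally Lipschitz first derivatives. Degree: set $d_1=d_2=1$, $d_3=2$, $d_4=3$. A nonzero vector $\tau=\sum_i\tau_iX_i$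 has degree $\max\{d_i:\tau_i\neq0\}$; a nonzero 2-vector $\tau=\sum_{i<j}\tau_{ij}X_i\wedge X_j$ has degree $\max\{d_i+d_j:\tau_{ij}\ne0\}$. For a $p$-dimensional submanifold $\Sigma$ ($p=1,2$) and $x\in\Sigma$, the pointwise degree $d_\Sigma(x)$ is the degree of a nonzero tangent $p$-vector $\tau_\Sigma(x)$ (the wedge product of a basis of $T_x\Sigma$), written in terms of the $X_i$'s evaluated at $x$. The degree of $\Sigma$ is $d(\Sigma)=\max_{x\in\Sigma}d_\Sigma(x)$. *)

theory Defs
  imports "HOL-Analysis.Analysis"
begin

section \<open>The Engel group\<close>

text \<open>Points of the Engel group are elements of \<open>real ^ 4\<close>, with components
  \<open>x $ 1, x $ 2, x $ 3, x $ 4\<close>; note that \<open>4 = 0\<close> in the index type \<open>4\<close>, so that its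
  order is not the expected one.\<close>

lemma vector_4 [simp]:
  "(vector [a, b, c, d] :: 'a::zero ^ 4) $ 1 = a"
  "(vector [a, b, c, d] :: 'a ^ 4) $ 2 = b"
  "(vector [a, b, c, d] :: 'a ^ 4) $ 3 = c"
  "(vector [a, b, c, d] :: 'a ^ 4) $ 4 = d"
  unfolding vector_def by auto

definition engel_X :: "4 \<Rightarrow> real ^ 4 \<Rightarrow> real ^ 4" where
  "engel_X i x =
     (if i = 1 then vector [1, 0, 0, 0]
      else if i = 2 then vector [0, 1, x $ 1, (x $ 1)\<^sup>2 / 2]
      else if i = 3 then vector [0, 0, 1, x $ 1]
      else vector [0, 0, 0, 1])"

lemma engel_X_simps [simp]:
  "engel_X 1 x = vector [1, 0, 0, 0]"
  "engel_X 2 x = vector [0, 1, x $ 1, (x $ 1)\<^sup>2 / 2]"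
  "engel_X 3 x = vector [0, 0, 1, x $ 1]"
  "engel_X 4 x = vector [0, 0, 0, 1]"
  by (simp_all add: engel_X_def)

text \<open>The group law is the one with identity \<open>0\<close> for which the fields \<open>engel_X i\<close> are left
  invariant; the lemmas below show that it is a group law with this property, and that it is the
  only operation with this property and right identity \<open>0\<close>.\<close>

definition engel_mult :: "real ^ 4 \<Rightarrow> real ^ 4 \<Rightarrow> real ^ 4" where
  "engel_mult x y =
     vector [x $ 1 + y $ 1,
             x $ 2 + y $ 2,
             x $ 3 + y $ 3 + x $ 1 * y $ 2,
             x $ 4 + y $ 4 + x $ 1 * y $ 3 + (x $ 1)\<^sup>2 / 2 * y $ 2]"

definition engel_dilation :: "real \<Rightarrow> real ^ 4 \<Rightarrow> real ^ 4" where
  "engel_dilation r x = vector [r * x $ 1, r * x $ 2, r ^ 2 * x $ 3, r ^ 3 * x $ 4]"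

lemma engel_mult_0_left: "engel_mult 0 x = x"
  and engel_mult_0_right: "engel_mult x 0 = x"
  and engel_mult_assoc: "engel_mult (engel_mult x y) z = engel_mult x (engel_mult y z)"
  by (simp_all add: engel_mult_def vec_eq_iff forall_4 algebra_simps power2_eq_square
      add_divide_distrib)

lemma engel_mult_inverse: "\<exists>y. engel_mult x y = 0 \<and> engel_mult y x = 0"
  by (rule exI[of _ "vector [- x $ 1, - x $ 2, - x $ 3 + x $ 1 * x $ 2,
        - x $ 4 + x $ 1 * x $ 3 - (x $ 1)\<^sup>2 / 2 * x $ 2]"])
    (simp add: engel_mult_def vec_eq_iff forall_4 algebra_simps power2_eq_square)

lemma engel_dilation_mult:
  "engel_dilation r (engel_mult x y) = engel_mult (engel_dilation r x) (engel_dilation r y)"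
  by (simp add: engel_dilation_def engel_mult_def vec_eq_iff forall_4 algebra_simps
      power2_eq_square power3_eq_cube)

lemma has_derivative_vec4I:
  fixes f :: "'a::real_normed_vector \<Rightarrow> real ^ 4"
  assumes "\<And>i. ((\<lambda>x. f x $ i) has_derivative (\<lambda>h. f' h $ i)) F"
  shows "(f has_derivative f') F"
proof -
  have "((\<lambda>x. \<Sum>i\<in>UNIV. f x $ i *\<^sub>R axis i 1) has_derivative
         (\<lambda>h. \<Sum>i\<in>UNIV. f' h $ i *\<^sub>R axis i (1::real))) F"
    by (intro has_derivative_sum has_derivative_scaleR_left assms)
  moreover have "(\<Sum>i\<in>UNIV. (v $ i) *\<^sub>R axis i (1::real)) = v" for v :: "real ^ 4"
    using basis_expansion[of v] by (simp add: scalar_mult_eq_scaleR)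
  ultimately show ?thesis by simp
qed

lemma engel_X_left_invariant:
  "\<exists>D. (engel_mult a has_derivative D) (at x) \<and> (\<forall>i. D (engel_X i x) = engel_X i (engel_mult a x))"
proof (intro exI conjI)
  let ?D = "\<lambda>h. vector [h $ 1, h $ 2, h $ 3 + a $ 1 * h $ 2,
     h $ 4 + a $ 1 * h $ 3 + (a $ 1)\<^sup>2 / 2 * h $ 2] :: real ^ 4"
  show "(engel_mult a has_derivative ?D) (at x)"
  proof (rule has_derivative_vec4I)
    fix i :: 4
    have "\<forall>i. ((\<lambda>x. engel_mult a x $ i) has_derivative (\<lambda>h. ?D h $ i)) (at x)"
      unfolding forall_4 engel_mult_def vector_4
      by (auto intro!: derivative_eq_intros bounded_linear_vec_nth[THEN bounded_linear.has_derivative])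
    then show "((\<lambda>x. engel_mult a x $ i) has_derivative (\<lambda>h. ?D h $ i)) (at x)" ..
  qed
  show "\<forall>i. ?D (engel_X i x) = engel_X i (engel_mult a x)"
    by (simp add: forall_4 vec_eq_iff engel_mult_def algebra_simps power2_eq_square
        add_divide_distrib)
qed

lemma engel_X_expansion:
  "v = (\<Sum>i\<in>UNIV. c $ i *\<^sub>R engel_X i x) \<longleftrightarrow>
   c = vector [v $ 1, v $ 2, v $ 3 - x $ 1 * v $ 2, v $ 4 - x $ 1 * v $ 3 + (x $ 1)\<^sup>2 / 2 * v $ 2]"
proof -
  have "p = v1 \<and> q = v2 \<and> r = v3 - y * v2 \<and> t = v4 - y * v3 + y\<^sup>2 / 2 * v2 \<longleftrightarrow>
    v1 = p \<and> v2 = q \<and> v3 = q * y + r \<and> v4 = q * (y\<^sup>2 / 2) + r * y + t"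
    for p q r t v1 v2 v3 v4 y :: real
    by (auto simp: algebra_simps power2_eq_square)
  from this[of "c $ 1" "v $ 1" "c $ 2" "v $ 2" "c $ 3" "v $ 3" "x $ 1" "c $ 4" "v $ 4"] show ?thesis
    by (simp add: vec_eq_iff forall_4 sum_4)
qed

lemma engel_mult_unique:
  assumes zero: "\<And>a. m a 0 = a"
    and inv: "\<And>a x. \<exists>D. (m a has_derivative D) (at x) \<and> (\<forall>i. D (engel_X i x) = engel_X i (m a x))"
  shows "m = engel_mult"
proof (intro ext)
  fix a x
  obtain D where D: "\<And>x. (m a has_derivative D x) (at x)"
      "\<And>x i. D x (engel_X i x) = engel_X i (m a x)"
    using inv[of a] by metis
  obtain E where E: "\<And>x. (engel_mult a has_derivative E x) (at x)"
      "\<And>x i. E x (engel_X i x) = engel_X i (engel_mult a x)"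
    using engel_X_left_invariant[of a] by metis
  have expand: "F v = (\<Sum>i\<in>UNIV. (SOME c. v = (\<Sum>i\<in>UNIV. c $ i *\<^sub>R engel_X i x)) $ i *\<^sub>R F (engel_X i x))"
    if "linear F" for F :: "real ^ 4 \<Rightarrow> real ^ 4" and v x
  proof -
    define c :: "real ^ 4" where "c = (SOME c. v = (\<Sum>i\<in>UNIV. c $ i *\<^sub>R engel_X i x))"
    have "v = (\<Sum>i\<in>UNIV. c $ i *\<^sub>R engel_X i x)"
      unfolding c_def by (rule someI_ex) (use engel_X_expansion in blast)
    then have "F v = F (\<Sum>i\<in>UNIV. c $ i *\<^sub>R engel_X i x)" by simp
    also have "\<dots> = (\<Sum>i\<in>UNIV. c $ i *\<^sub>R F (engel_X i x))"
      using that by (simp add: linear_sum linear_scale)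
    finally show ?thesis by (simp add: c_def)
  qed
  have const: "m a x $ k = engel_mult a x $ k"
    if "\<And>x i. engel_X i (m a x) $ k = engel_X i (engel_mult a x) $ k" for k x
  proof -
    have comp: "D y v $ k = E y v $ k" for y v
      using expand[OF has_derivative_linear[OF D(1)], of y v y]
        expand[OF has_derivative_linear[OF E(1)], of y v y]
      by (simp add: D(2) E(2) that)
    have "((\<lambda>y. m a y $ k - engel_mult a y $ k) has_derivative (\<lambda>h. 0)) (at y within UNIV)" for y
    proof -
      have "((\<lambda>y. m a y $ k - engel_mult a y $ k) has_derivative (\<lambda>h. D y h $ k - E y h $ k)) (at y)"
        by (intro has_derivative_diff bounded_linear.has_derivative[OF bounded_linear_vec_nth] D E)
      then show ?thesis by (simp add: comp)
    qed
    then have "m a x $ k - engel_mult a x $ k = m a 0 $ k - engel_mult a 0 $ k"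
      by (intro has_derivative_zero_unique[where s = UNIV]) auto
    then show ?thesis by (simp add: zero engel_mult_0_right)
  qed
  have 1: "m a x $ 1 = engel_mult a x $ 1" for x
  proof (rule const)
    fix x i
    have "\<forall>i. engel_X i (m a x) $ 1 = engel_X i (engel_mult a x) $ 1" by (simp add: forall_4)
    then show "engel_X i (m a x) $ 1 = engel_X i (engel_mult a x) $ 1" ..
  qed
  have "engel_X i (m a x) = engel_X i (engel_mult a x)" for i x
    by (simp add: engel_X_def 1)
  then show "m a x = engel_mult a x"
    by (simp add: vec_eq_iff const)
qed


section \<open>Homogeneous distances\<close>

definition homogeneous_distance :: "(real ^ 4 \<Rightarrow> real ^ 4 \<Rightarrow> real) \<Rightarrow> bool" where
  "homogeneous_distance \<rho> \<longleftrightarrow>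
     Metric_space UNIV \<rho> \<and>
     continuous_on UNIV (\<lambda>(x, y). \<rho> x y) \<and>
     (\<forall>a x y. \<rho> (engel_mult a x) (engel_mult a y) = \<rho> x y) \<and>
     (\<forall>r>0. \<forall>x y. \<rho> (engel_dilation r x) (engel_dilation r y) = r * \<rho> x y)"


section \<open>The left invariant metric\<close>

definition engel_coords :: "real ^ 4 \<Rightarrow> real ^ 4 \<Rightarrow> real ^ 4" where
  "engel_coords x v = (THE c. v = (\<Sum>i\<in>UNIV. c $ i *\<^sub>R engel_X i x))"

lemma engel_coords_eq:
  "engel_coords x v =
     vector [v $ 1, v $ 2, v $ 3 - x $ 1 * v $ 2, v $ 4 - x $ 1 * v $ 3 + (x $ 1)\<^sup>2 / 2 * v $ 2]"
  unfolding engel_coords_def engel_X_expansion by simp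

lemma engel_coords_expansion: "(\<Sum>i\<in>UNIV. engel_coords x v $ i *\<^sub>R engel_X i x) = v"
  using engel_X_expansion[of v "engel_coords x v" x] by (simp add: engel_coords_eq)

text \<open>The inner product on the tangent space at \<open>x\<close> for which the \<open>engel_X i x\<close> are
  orthonormal:\<close>

definition engel_metric :: "real ^ 4 \<Rightarrow> real ^ 4 \<Rightarrow> real ^ 4 \<Rightarrow> real" where
  "engel_metric x v w = engel_coords x v \<bullet> engel_coords x w"

lemma engel_metric_orthonormal:
  "engel_metric x (engel_X i x) (engel_X j x) = (if i = j then 1 else 0)"
proof -
  have "engel_coords x (engel_X i x) = axis i 1" for i
  proof -
    have "\<forall>i. engel_coords x (engel_X i x) = axis i 1"
      by (simp add: forall_4 engel_coords_eq vec_eq_iff axis_def power2_eq_square)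
    then show ?thesis ..
  qed
  then show ?thesis by (simp add: engel_metric_def inner_axis_axis)
qed


section \<open>Submanifolds\<close>

text \<open>The dimension of a submanifold is the cardinality of the index type \<open>'p\<close> of its parameter
  space \<open>real ^ 'p\<close>. A local parametrization is a homeomorphism from an open set \<open>U\<close> onto a
  relatively open subset of \<open>\<Sigma>\<close> that is an immersion with locally Lipschitz (hence continuous)
  derivative.\<close>

definition local_parametrization ::
    "(real ^ 4) set \<Rightarrow> (real ^ 'p::finite) set \<Rightarrow> (real ^ 'p \<Rightarrow> real ^ 4) \<Rightarrow> bool" where
  "local_parametrization \<Sigma> U \<phi> \<longleftrightarrow>
     open U \<and>
     (\<exists>\<psi>. homeomorphism U (\<phi> ` U) \<phi> \<psi>) \<and>
     openin (top_of_set \<Sigma>) (\<phi> ` U) \<and>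
     (\<exists>\<phi>' :: real ^ 'p \<Rightarrow> (real ^ 'p) \<Rightarrow>\<^sub>L (real ^ 4).
        (\<forall>u\<in>U. (\<phi> has_derivative blinfun_apply (\<phi>' u)) (at u) \<and> inj (blinfun_apply (\<phi>' u))) \<and>
        (\<forall>u\<in>U. \<exists>e>0. \<exists>L. lipschitz_on L (U \<inter> ball u e) \<phi>'))"

definition c11_submanifold :: "'p::finite itself \<Rightarrow> (real ^ 4) set \<Rightarrow> bool" where
  "c11_submanifold _ \<Sigma> \<longleftrightarrow>
     (\<forall>x\<in>\<Sigma>. \<exists>(U :: (real ^ 'p) set) \<phi>. local_parametrization \<Sigma> U \<phi> \<and> x \<in> \<phi> ` U)"

definition tangent_space :: "(real ^ 4) set \<Rightarrow> real ^ 4 \<Rightarrow> (real ^ 4) set" where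
  "tangent_space \<Sigma> x =
     {v. \<exists>\<gamma> e. e > 0 \<and> \<gamma> C1_differentiable_on {-e<..<e} \<and> \<gamma> ` {-e<..<e} \<subseteq> \<Sigma> \<and>
          \<gamma> 0 = x \<and> (\<gamma> has_vector_derivative v) (at 0)}"


section \<open>Degree\<close>

definition engel_weight :: "4 \<Rightarrow> nat" where
  "engel_weight i = (if i = 1 \<or> i = 2 then 1 else if i = 3 then 2 else 3)"

text \<open>The coefficient of the wedge product of \<open>v $ j\<close>, \<open>j :: 'p\<close>, with respect to the wedge product
  of \<open>engel_X (s j) x\<close>, \<open>j :: 'p\<close>, is the minor below. The map \<open>s\<close> is not required to be
  increasing: permuting the indices only changes the sign of the coefficient, and the minor
  vanishes if \<open>s\<close> is not injective.\<close>

definition wedge_coeff :: "real ^ 4 \<Rightarrow> real ^ 4 ^ 'p::finite \<Rightarrow> ('p \<Rightarrow> 4) \<Rightarrow> real" where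
  "wedge_coeff x v s = det (\<chi> i j. engel_coords x (v $ i) $ s j)"

definition wedge_degree :: "real ^ 4 \<Rightarrow> real ^ 4 ^ 'p::finite \<Rightarrow> nat" where
  "wedge_degree x v = Max {\<Sum>j\<in>UNIV. engel_weight (s j) | s. wedge_coeff x v s \<noteq> 0}"

definition is_basis_of :: "real ^ 4 ^ 'p::finite \<Rightarrow> (real ^ 4) set \<Rightarrow> bool" where
  "is_basis_of v T \<longleftrightarrow>
     inj (\<lambda>j. v $ j) \<and> independent (range (\<lambda>j. v $ j)) \<and> span (range (\<lambda>j. v $ j)) = T"

lemma wedge_coeff_nonzero:
  fixes v w :: "real ^ 4 ^ 'p::finite"
  assumes v: "is_basis_of v T" and w: "is_basis_of w T" and nz: "wedge_coeff x v s \<noteq> 0"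
  shows "wedge_coeff x w s \<noteq> 0"
proof -
  have "\<exists>c. v $ i = (\<Sum>k\<in>UNIV. c k *\<^sub>R w $ k)" for i
  proof -
    have "v $ i \<in> span (range (\<lambda>k. w $ k))"
      using v w unfolding is_basis_of_def by (metis rangeI span_base)
    then obtain c where "v $ i = (\<Sum>y\<in>range (\<lambda>k. w $ k). c y *\<^sub>R y)"
      by (auto simp: span_finite)
    also have "\<dots> = (\<Sum>k\<in>UNIV. c (w $ k) *\<^sub>R w $ k)"
      using w unfolding is_basis_of_def by (subst sum.reindex) auto
    finally show ?thesis by (rule exI[of _ "\<lambda>k. c (w $ k)"])
  qed
  then obtain c where c: "\<And>i. v $ i = (\<Sum>k\<in>UNIV. c i k *\<^sub>R w $ k)" by metis
  have lin: "linear (\<lambda>v. engel_coords x v $ j)" for j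
  proof -
    have "\<forall>j. linear (\<lambda>v. engel_coords x v $ j)"
      by (auto simp: forall_4 engel_coords_eq algebra_simps intro!: linearI)
    then show ?thesis ..
  qed
  have "(\<chi> i j. engel_coords x (v $ i) $ s j) = (\<chi> i k. c i k) ** (\<chi> i j. engel_coords x (w $ i) $ s j)"
    unfolding c by (simp add: matrix_matrix_mult_def vec_eq_iff linear_sum[OF lin] linear_scale[OF lin])
  then have "wedge_coeff x v s = det (\<chi> i k. c i k) * wedge_coeff x w s"
    by (simp add: wedge_coeff_def det_mul)
  with nz show ?thesis by auto
qed

lemma wedge_degree_basis_independent:
  fixes v w :: "real ^ 4 ^ 'p::finite"
  assumes "is_basis_of v T" and "is_basis_of w T"
  shows "wedge_degree x v = wedge_degree x w"
proof -
  have "wedge_coeff x v s \<noteq> 0 \<longleftrightarrow> wedge_coeff x w s \<noteq> 0" for s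
    using wedge_coeff_nonzero assms by blast
  then show ?thesis by (simp add: wedge_degree_def)
qed

definition pointwise_degree :: "'p::finite itself \<Rightarrow> (real ^ 4) set \<Rightarrow> real ^ 4 \<Rightarrow> nat" where
  "pointwise_degree _ \<Sigma> x =
     wedge_degree x (SOME v :: real ^ 4 ^ 'p. is_basis_of v (tangent_space \<Sigma> x))"

definition submanifold_degree :: "'p::finite itself \<Rightarrow> (real ^ 4) set \<Rightarrow> nat" where
  "submanifold_degree P \<Sigma> = Max (pointwise_degree P \<Sigma> ` \<Sigma>)"


section \<open>Riemannian surface measure\<close>

text \<open>The square root of the Gram determinant of the coordinate vectors of \<open>\<phi>\<close> with respect to the
  left invariant metric:\<close>

definition riemannian_jacobian :: "(real ^ 'p::finite \<Rightarrow> real ^ 4) \<Rightarrow> real ^ 'p \<Rightarrow> real" where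
  "riemannian_jacobian \<phi> u =
     sqrt (det (\<chi> i j. engel_metric (\<phi> u)
       (frechet_derivative \<phi> (at u) (axis i 1)) (frechet_derivative \<phi> (at u) (axis j 1))))"

text \<open>The surface measure is the unique Borel measure on \<open>\<Sigma>\<close> that has the Riemannian volume
  density in every local parametrization.\<close>

definition riemannian_surface_measure ::
    "'p::finite itself \<Rightarrow> (real ^ 4) set \<Rightarrow> (real ^ 4) measure \<Rightarrow> bool" where
  "riemannian_surface_measure _ \<Sigma> \<mu> \<longleftrightarrow>
     sets \<mu> = sets (restrict_space borel \<Sigma>) \<and>
     (\<forall>(U :: (real ^ 'p) set) \<phi> A. local_parametrization \<Sigma> U \<phi> \<longrightarrow> A \<in> sets borel \<longrightarrow> A \<subseteq> U \<longrightarrow>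
        emeasure \<mu> (\<phi> ` A) = (\<integral>\<^sup>+ u\<in>A. ennreal (riemannian_jacobian \<phi> u) \<partial>lborel))"

end

theory Submission
  imports Defs "HOL-Real_Asymp.Real_Asymp"
begin

text \<open>
  Write \<open>q y = engel_coords x (y - x)\<close>. The group law is polynomial in such a way that this is exactly
  the increment \<open>x\<^sup>-\<^sup>1 y\<close>, and by homogeneity the ball of radius \<open>r\<close> around \<open>x\<close> contains every
  \<open>y\<close> with \<open>\<bar>q\<^sub>i y\<bar> \<le> \<eta> r^w\<^sub>i\<close>, where \<open>w = (1, 1, 2, 3)\<close> are the weights
  (\<open>homogeneous_distance_box\<close>). In a chart \<open>\<phi>\<close> with \<open>\<phi> u = x\<close> the surface measure has a continuous
  positive density, so the theorem asks for sets of parameters \<open>v\<close> on which \<open>q (\<phi> (u + v))\<close> stays in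
  this box and whose Lebesgue measure is of order \<open>r^\<gamma>\<close> with \<open>\<gamma> < d\<close>. Slabs
  \<open>\<bar>v\<bar> \<lesssim> r^\<alpha>\<close>, \<open>\<bar>e \<bullet> v\<bar> \<lesssim> r^\<beta>\<close> with a unit vector \<open>e\<close> suffice; their measure is of order
  \<open>r^(\<alpha> (p - 1) + \<beta>)\<close> (\<open>emeasure_slab_ge\<close>, \<open>density_infinite_if_slab\<close>).

  Let \<open>\<theta>\<^sub>i\<close> be the coordinate functionals of the differential of \<open>\<phi>\<close> at \<open>u\<close> in the left invariant
  frame (\<open>tangent_coord u i\<close>). Since \<open>\<phi>\<close> is of class \<open>C\<^sup>1\<^sup>,\<^sup>1\<close>, \<open>q\<^sub>i = \<theta>\<^sub>i v + O(\<bar>v\<bar>\<^sup>2)\<close>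
  (\<open>quadratic_remainder\<close>). The tangent \<open>p\<close>-vector at \<open>x\<close> has degree less than \<open>d\<close>, which means that
  every \<open>p \<times> p\<close> minor of \<open>\<theta>\<close> of weight at least \<open>d\<close> vanishes; because \<open>\<phi>\<close> is an immersion, this
  forces the following, and in each case there is a slab that does it.

  \<^item> If \<open>\<theta>\<^sub>3\<close> and \<open>\<theta>\<^sub>4\<close> are multiples of one functional \<open>e\<close>, take \<open>\<alpha> = 3/2\<close>, which makes the quadratic
    remainders of size \<open>r\<^sup>3\<close>, and \<open>\<beta>\<close> as large as \<open>\<theta>\<^sub>3\<close>, \<open>\<theta>\<^sub>4\<close> require: \<open>\<beta> = 3\<close> in general, \<open>\<beta> = 2\<close> if
    \<open>\<theta>\<^sub>4 = 0\<close>, \<open>\<beta> = 3/2\<close> if both vanish (\<open>density_infinite_rank_one\<close>). For surfaces this covers \<open>d = 5\<close>,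
    where the minor of \<open>\<theta>\<^sub>3, \<theta>\<^sub>4\<close> vanishes (exponent \<open>9/2\<close> or \<open>7/2\<close>), and \<open>d = 4\<close>, where \<open>\<theta>\<^sub>4 = 0\<close> (exponent
    \<open>7/2\<close>); for curves it covers \<open>d = 3\<close> with \<open>\<theta>\<^sub>4 = 0\<close> (exponent \<open>2\<close>) and \<open>d = 2\<close> with
    \<open>\<theta>\<^sub>3 = \<theta>\<^sub>4 = 0\<close> (exponent \<open>3/2\<close>).

  \<^item> For surfaces with \<open>d = 3\<close> one has \<open>\<theta>\<^sub>3 = \<theta>\<^sub>4 = 0\<close>, but the previous slabs only have measure of the
    critical order \<open>r\<^sup>3\<close>. Here the degree of the whole surface enters: no tangent vector at any point
    has an \<open>X\<^sub>4\<close>-component. The resulting differential equation for \<open>q\<^sub>4\<close> improves its remainder to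
    \<open>O(\<bar>v\<bar>\<^sup>3)\<close> (\<open>cubic_remainder\<close>), so that full balls \<open>\<bar>v\<bar> \<lesssim> r\<close> of measure of order \<open>r\<^sup>2\<close> are
    admissible (\<open>density_infinite_horizontal\<close>).

  \<^item> Values of \<open>d\<close> below \<open>p + 1\<close> contradict that \<open>\<phi>\<close> is an immersion. For \<open>d\<close> above
    the largest weight \<open>2 p + 1\<close> of a \<open>p\<close>-vector, the slabs with \<open>\<alpha> = 2\<close>, \<open>\<beta> = 3\<close> around
    an arbitrary point have measure of order \<open>r^(2 p + 1)\<close> (\<open>density_infinite_above_top_weight\<close>).\<close>

section \<open>Group increments in left invariant coordinates\<close>

lemma linear_engel_coords: "linear (engel_coords x)"
  by (rule linearI) (simp_all add: engel_coords_eq vec_eq_iff forall_4 algebra_simps)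

lemma bounded_linear_engel_coords: "bounded_linear (engel_coords x)"
  using linear_engel_coords linear_conv_bounded_linear by blast

lemma bounded_linear_engel_coords_nth: "bounded_linear (\<lambda>v. engel_coords x v $ i)"
  by (rule bounded_linear_compose[OF bounded_linear_vec_nth bounded_linear_engel_coords])

lemma linear_engel_coords_nth: "linear (\<lambda>v. engel_coords x v $ i)"
  by (rule bounded_linear.linear[OF bounded_linear_engel_coords_nth])

lemma engel_coords_eq_0_iff: "engel_coords x v = 0 \<longleftrightarrow> v = 0"
proof
  assume "engel_coords x v = 0"
  then show "v = 0" using engel_coords_expansion[of x v] by simp
qed (simp add: linear_0[OF linear_engel_coords])

text \<open>The coordinates of the Euclidean difference \<open>y - x\<close> in the left invariant frame at the base point
  \<open>x\<close> are the group increment \<open>x\<^sup>-\<^sup>1 y\<close>. This links the metric side, where \<open>x\<^sup>-\<^sup>1 y\<close> is measured, to the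
  differential side, where the degree is read off from \<open>engel_coords x\<close>.\<close>

lemma engel_mult_coords: "engel_mult x (engel_coords x (y - x)) = y"
  by (simp add: engel_mult_def engel_coords_eq vec_eq_iff forall_4 algebra_simps power2_eq_square)

section \<open>Boxes inside homogeneous balls\<close>

lemma continuous_on_homogeneous_distance:
  assumes "homogeneous_distance \<rho>"
  shows "continuous_on UNIV (\<rho> x)"
proof -
  have "continuous_on UNIV (\<lambda>(x, y). \<rho> x y)"
    using assms by (simp add: homogeneous_distance_def)
  then have "continuous_on UNIV (\<lambda>y. case (x, y) of (x, y) \<Rightarrow> \<rho> x y)"
    by (rule continuous_on_compose2) (auto intro: continuous_on_Pair continuous_on_const continuous_on_id)
  then show ?thesis by simp
qed

text \<open>Only continuity at \<open>0\<close> gives a box inside the unit ball around \<open>0\<close>; dilations and left translations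
  carry it to every scale and every center.\<close>

lemma homogeneous_distance_box:
  assumes "homogeneous_distance \<rho>"
  obtains \<eta> where "\<eta> > 0"
    "\<And>x y r. r > 0 \<Longrightarrow> (\<And>i. \<bar>engel_coords x (y - x) $ i\<bar> \<le> \<eta> * r ^ engel_weight i) \<Longrightarrow> \<rho> x y \<le> r"
proof -
  interpret Metric_space UNIV \<rho>
    using assms by (simp add: homogeneous_distance_def)
  have inv: "\<rho> (engel_mult a x) (engel_mult a y) = \<rho> x y" for a x y
    using assms by (simp add: homogeneous_distance_def)
  have dil: "\<rho> (engel_dilation r x) (engel_dilation r y) = r * \<rho> x y" if "r > 0" for r x y
    using assms that by (simp add: homogeneous_distance_def)
  have "continuous_on UNIV (\<rho> 0)"
    by (rule continuous_on_homogeneous_distance[OF assms])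
  then obtain \<delta> where \<delta>: "\<delta> > 0" "\<And>y. dist y 0 < \<delta> \<Longrightarrow> dist (\<rho> 0 y) (\<rho> 0 0) < 1"
    unfolding continuous_on_iff by (metis UNIV_I zero_less_one)
  \<comment> \<open>the \<open>l\<^sup>1\<close> norm of a point of the box of size \<open>\<delta> / 8\<close> is at most \<open>\<delta> / 2\<close>\<close>
  show thesis
  proof
    show "\<delta> / 8 > 0" using \<delta> by simp
    fix x y :: "real ^ 4" and r :: real
    assume r: "r > 0" and le: "\<And>i. \<bar>engel_coords x (y - x) $ i\<bar> \<le> \<delta> / 8 * r ^ engel_weight i"
    define q where "q = engel_coords x (y - x)"
    define q' where "q' = engel_dilation (1 / r) q"
    have q: "q = engel_dilation r q'"
      using r by (simp add: q'_def engel_dilation_def vec_eq_iff forall_4 field_simps)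
    have "\<forall>i. \<bar>q' $ i\<bar> \<le> \<delta> / 8"
      using r le[of 1] le[of 2] le[of 3] le[of 4]
      by (simp add: forall_4 q'_def q_def[symmetric] engel_dilation_def engel_weight_def abs_mult
          field_simps)
    then have "(\<Sum>i\<in>UNIV. \<bar>q' $ i\<bar>) \<le> (\<Sum>i\<in>(UNIV :: 4 set). \<delta> / 8)"
      by (intro sum_mono) auto
    then have "norm q' \<le> 4 * (\<delta> / 8)"
      using norm_le_l1_cart[of q'] by simp
    then have "dist q' 0 < \<delta>" using \<delta>(1) by simp
    then have "\<rho> 0 q' < 1"
      using \<delta>(2)[of q'] mdist_zero[of 0] by (simp add: dist_real_def)
    have "\<rho> x y = \<rho> (engel_mult x 0) (engel_mult x q)"
      by (simp add: q_def engel_mult_coords engel_mult_0_right)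
    also have "\<dots> = \<rho> (engel_dilation r 0) (engel_dilation r q')"
    proof -
      have "engel_dilation r 0 = 0" by (simp add: engel_dilation_def vec_eq_iff forall_4)
      then show ?thesis by (simp add: inv flip: q)
    qed
    also have "\<dots> = r * \<rho> 0 q'" using dil r by blast
    also have "\<dots> \<le> r" using \<open>\<rho> 0 q' < 1\<close> r by simp
    finally show "\<rho> x y \<le> r" .
  qed
qed

lemma closed_homogeneous_ball:
  assumes "homogeneous_distance \<rho>"
  shows "closed (Metric_space.mcball UNIV \<rho> x r)"
proof -
  interpret Metric_space UNIV \<rho>
    using assms by (simp add: homogeneous_distance_def)
  have "continuous_on UNIV (\<rho> x)"
    by (rule continuous_on_homogeneous_distance[OF assms])
  then show ?thesis
    unfolding mcball_def by (auto intro!: closed_Collect_le continuous_intros)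
qed

section \<open>Volume of slabs\<close>

text \<open>A rotation takes \<open>e\<close> to a coordinate axis; the slab then contains the box with half-width \<open>b / n\<close> in
  that direction and \<open>a / n\<close> in the others, the factor \<open>1 / n\<close> making its \<open>l\<^sup>1\<close> size at most \<open>a\<close>.\<close>

lemma emeasure_slab_ge:
  fixes e u :: "real ^ 'n::{finite, wellorder}"
  assumes "norm e = 1" and b: "0 \<le> b" "b \<le> a"
  shows "ennreal (b * a ^ (CARD('n) - 1) / real CARD('n) ^ CARD('n))
    \<le> emeasure lborel {w. norm (w - u) \<le> a \<and> \<bar>e \<bullet> (w - u)\<bar> \<le> b}" (is "_ \<le> emeasure lborel ?S")
proof -
  define n where "n = CARD('n::{finite, wellorder})"
  have n: "n > 0" "real n \<ge> 1" by (simp_all add: n_def Suc_leI)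
  define k :: "'n::{finite, wellorder}" where "k = undefined"
  obtain T :: "real ^ 'n::{finite, wellorder} \<Rightarrow> real ^ 'n::{finite, wellorder}" where T: "orthogonal_transformation T" "T (axis k 1) = e"
    using orthogonal_transformation_exists_1[of "axis k 1" e] assms by (auto simp: norm_axis_1)
  define h :: "real ^ 'n::{finite, wellorder}" where "h = (\<chi> j. if j = k then b / n else a / n)"
  have h0: "h $ j \<ge> 0" for j using b by (simp add: h_def)
  let ?B = "cbox (- h) h"
  have "closed ?S"
    by (intro closed_Collect_conj closed_Collect_le continuous_intros)
  then have borelS: "?S \<in> sets borel" by (rule borel_closed)
  have "bounded ?S"
    by (rule bounded_subset[of "cball u a"]) (auto simp: dist_norm norm_minus_commute)
  have sub: "(+) u ` T ` ?B \<subseteq> ?S"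
  proof clarsimp
    fix v assume v: "v \<in> ?B"
    have vj: "\<bar>v $ j\<bar> \<le> h $ j" for j
      using v by (auto simp: mem_box_cart abs_le_iff minus_le_iff)
    have "norm (T v) = norm v" using T(1) by (simp add: orthogonal_transformation_norm)
    also have "\<dots> \<le> (\<Sum>j\<in>UNIV. \<bar>v $ j\<bar>)" by (rule norm_le_l1_cart)
    also have "\<dots> \<le> (\<Sum>j\<in>(UNIV :: 'n::{finite, wellorder} set). a / n)"
    proof (rule sum_mono)
      fix j
      show "\<bar>v $ j\<bar> \<le> a / n" using vj[of j] b by (simp add: h_def divide_right_mono split: if_splits)
          (meson b(2) divide_right_mono of_nat_0_le_iff order_trans)
    qed
    also have "\<dots> = a" using n by (simp add: n_def)
    finally have 1: "norm (T v) \<le> a" .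
    have "e \<bullet> T v = axis k 1 \<bullet> v"
      using T by (metis orthogonal_transformation_def)
    then have "\<bar>e \<bullet> T v\<bar> = \<bar>v $ k\<bar>" by (simp add: inner_axis')
    also have "\<dots> \<le> b / n" using vj[of k] by (simp add: h_def)
    also have "\<dots> \<le> b" using n b by (simp add: divide_le_eq mult_left_le mult.commute[of b] mult_right_mono[of 1 "real n" b, simplified])
    finally show "norm (T v) \<le> a \<and> \<bar>e \<bullet> T v\<bar> \<le> b" using 1 by simp
  qed
  have lin: "linear T" using T(1) by (simp add: orthogonal_transformation_linear)
  have "b * a ^ (n - 1) / real n ^ n = (\<Prod>j\<in>UNIV. h $ j)"
  proof -
    have "(\<Prod>j\<in>UNIV. h $ j) = (b / n) * (\<Prod>j\<in>UNIV - {k}. a / n)"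
      unfolding h_def by (subst prod.remove[of _ k]) auto
    also have "\<dots> = (b / n) * (a / n) ^ (n - 1)"
      by (simp add: card_Diff_singleton n_def)
    also have "\<dots> = b * a ^ (n - 1) / real n ^ n"
      using n by (cases n) (simp_all add: power_divide)
    finally show ?thesis by simp
  qed
  also have "\<dots> \<le> (\<Prod>j\<in>UNIV. h $ j - (- h) $ j)"
    using h0 by (intro prod_mono) auto
  also have "\<dots> = measure lborel ?B"
    using h0 by (subst content_cbox_cart) (auto simp: box_ne_empty Basis_vec_def inner_axis)
  also have "\<dots> = measure lebesgue (T ` ?B)"
    using T(1) by (simp add: measure_orthogonal_image measure_completion)
  also have "\<dots> = measure lebesgue ((+) u ` T ` ?B)"
    by (simp add: measure_translation)
  also have "\<dots> \<le> measure lebesgue ?S"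
  proof (rule measure_mono_fmeasurable[OF sub])
    have "compact ((+) u ` T ` ?B)"
      using lin by (intro compact_translation compact_continuous_image linear_continuous_on)
        (auto simp: linear_conv_bounded_linear)
    then show "(+) u ` T ` ?B \<in> sets lebesgue"
      using lmeasurable_compact by blast
    show "?S \<in> lmeasurable"
      using \<open>closed ?S\<close> \<open>bounded ?S\<close> lmeasurable_compact compact_eq_bounded_closed by blast
  qed
  finally have "ennreal (b * a ^ (n - 1) / real n ^ n) \<le> ennreal (measure lborel ?S)"
    using borelS by (simp add: measure_completion ennreal_leI)
  also have "\<dots> = emeasure lborel ?S"
    using \<open>bounded ?S\<close> emeasure_bounded_finite[of ?S] by (simp add: emeasure_eq_ennreal_measure)
  finally show ?thesis by (simp add: n_def)
qed

section \<open>Linear algebra: determinants and functionals\<close>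

lemma continuous_on_det:
  fixes A :: "'a::topological_space \<Rightarrow> real ^ 'n ^ 'n::finite"
  assumes "\<And>i j. continuous_on S (\<lambda>x. A x $ i $ j)"
  shows "continuous_on S (\<lambda>x. det (A x))"
  unfolding det_def by (intro continuous_on_sum continuous_on_mult continuous_on_prod continuous_on_const assms)

text \<open>The determinant of the segment from the identity to the Gram matrix is continuous and never \<open>0\<close>,
  as every matrix on it is positive definite; so it keeps the sign that it has at the identity.\<close>

lemma gram_det_pos:
  fixes c :: "'n::finite \<Rightarrow> 'a::real_inner"
  assumes indep: "\<And>z :: real ^ 'n. (\<Sum>i\<in>UNIV. (z $ i) *\<^sub>R c i) = 0 \<Longrightarrow> z = 0"
  shows "det (\<chi> i j. c i \<bullet> c j) > 0"
proof -
  define M :: "real \<Rightarrow> real ^ 'n ^ 'n" where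
    "M t = (\<chi> i j. (1 - t) * (if i = j then 1 else 0) + t * (c i \<bullet> c j))" for t
  have nz: "det (M t) \<noteq> 0" if t: "0 \<le> t" "t \<le> 1" for t
  proof -
    have "z = 0" if z: "M t *v z = 0" for z
    proof -
      have "z \<bullet> (M t *v z) = (1 - t) * (z \<bullet> z) +
          t * ((\<Sum>i\<in>UNIV. (z $ i) *\<^sub>R c i) \<bullet> (\<Sum>j\<in>UNIV. (z $ j) *\<^sub>R c j))"
      proof -
        have row: "(M t *v z) $ i = (1 - t) * z $ i + t * (c i \<bullet> (\<Sum>j\<in>UNIV. (z $ j) *\<^sub>R c j))" for i
        proof -
          have "(M t *v z) $ i = (\<Sum>j\<in>UNIV. (1 - t) * (if i = j then z $ j else 0) + t * (c i \<bullet> ((z $ j) *\<^sub>R c j)))"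
            unfolding matrix_vector_mult_def M_def by (auto intro!: sum.cong simp: algebra_simps)
          also have "\<dots> = (1 - t) * z $ i + t * (c i \<bullet> (\<Sum>j\<in>UNIV. (z $ j) *\<^sub>R c j))"
            by (simp add: sum.distrib inner_sum_right flip: sum_distrib_left)
          finally show ?thesis .
        qed
        have "z \<bullet> (M t *v z) = (\<Sum>i\<in>UNIV. (1 - t) * (z $ i * z $ i) +
            t * (((z $ i) *\<^sub>R c i) \<bullet> (\<Sum>j\<in>UNIV. (z $ j) *\<^sub>R c j)))"
          unfolding inner_vec_def row by (intro sum.cong) (auto simp: algebra_simps)
        also have "\<dots> = (1 - t) * (z \<bullet> z) +
            t * ((\<Sum>i\<in>UNIV. (z $ i) *\<^sub>R c i) \<bullet> (\<Sum>j\<in>UNIV. (z $ j) *\<^sub>R c j))"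
          by (simp add: sum.distrib inner_sum_left inner_vec_def flip: sum_distrib_left)
        finally show ?thesis .
      qed
      then have sum0: "(1 - t) * (z \<bullet> z) +
          t * ((\<Sum>i\<in>UNIV. (z $ i) *\<^sub>R c i) \<bullet> (\<Sum>j\<in>UNIV. (z $ j) *\<^sub>R c j)) = 0"
        using z by simp
      show "z = 0"
      proof (cases "t = 1")
        case True
        then show ?thesis using sum0 indep by simp
      next
        case False
        have "(1 - t) * (z \<bullet> z) = 0"
          using sum0 t by (simp add: add_nonneg_eq_0_iff)
        then show ?thesis using False by simp
      qed
    qed
    then have "invertible (M t)"
      using invertible_left_inverse matrix_left_invertible_ker by blast
    then show ?thesis by (simp add: invertible_det_nz)
  qed
  have cont: "continuous_on {0..1} (\<lambda>t. det (M t))"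
    by (intro continuous_on_det) (auto simp: M_def intro!: continuous_intros)
  have "M 0 = mat 1" by (simp add: M_def mat_def vec_eq_iff)
  then have M0: "det (M 0) = 1" by simp
  have "det (M 1) > 0"
  proof (rule ccontr)
    assume "\<not> det (M 1) > 0"
    then have "\<exists>t\<ge>0. t \<le> 1 \<and> det (M t) = 0"
      using M0 cont by (intro IVT2') auto
    then show False using nz by blast
  qed
  moreover have "M 1 = (\<chi> i j. c i \<bullet> c j)" by (simp add: M_def vec_eq_iff)
  ultimately show ?thesis by simp
qed

text \<open>The index type of the parameters is an arbitrary type with one or two elements, so the usual
  formulas are needed with the indices named.\<close>

lemma det_UNIV_singleton:
  fixes A :: "'a::comm_ring_1 ^ 'n::finite ^ 'n"
  assumes "UNIV = {a :: 'n}"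
  shows "det A = A $ a $ a"
  unfolding det_def by (simp add: assms sign_id)

lemma det_UNIV_doubleton:
  fixes A :: "'a::comm_ring_1 ^ 'n::finite ^ 'n"
  assumes ab: "UNIV = {a, b :: 'n}" "a \<noteq> b"
  shows "det A = A $ a $ a * A $ b $ b - A $ a $ b * A $ b $ a"
proof -
  have perms: "{p. p permutes (UNIV :: 'n set)} = {id, Transposition.transpose a b}"
    unfolding ab(1) permutes_doubleton_iff by auto
  have "Transposition.transpose a b \<noteq> id"
    using ab(2) by (metis id_apply transpose_apply_first)
  then show ?thesis
    unfolding det_def perms using ab(2) by (simp add: ab(1) sign_swap_id sign_id)
qed

lemma linear_functional_unit_vector:
  fixes f :: "'a::euclidean_space \<Rightarrow> real"
  assumes "linear f"
  obtains e m where "norm e = 1" "\<And>h. f h = m * (e \<bullet> h)"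
proof -
  define g where "g = adjoint f 1"
  have g: "f h = g \<bullet> h" for h
    using adjoint_works[OF assms, of h 1] by (simp add: g_def inner_commute)
  show thesis
  proof (cases "g = 0")
    case True
    obtain b :: 'a where "b \<in> Basis" using nonempty_Basis by blast
    then show ?thesis using that[of b 0] g True by simp
  next
    case False
    then show ?thesis using that[of "g /\<^sub>R norm g" "norm g"] g by simp
  qed
qed

section \<open>Charts and tangent spaces\<close>

text \<open>The derivative is a parameter, rather than chosen inside each proof, so that all estimates speak of the
  same locally Lipschitz map into the bounded linear maps.\<close>

locale c11_chart =
  fixes \<Sigma> :: "(real ^ 4) set"
    and U :: "(real ^ 'p::{finite, wellorder}) set"
    and \<phi> :: "real ^ 'p::{finite, wellorder} \<Rightarrow> real ^ 4"
    and \<phi>' :: "real ^ 'p::{finite, wellorder} \<Rightarrow> (real ^ 'p::{finite, wellorder}) \<Rightarrow>\<^sub>L (real ^ 4)"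
  assumes parametrization: "local_parametrization \<Sigma> U \<phi>"
    and has_derivative: "u \<in> U \<Longrightarrow> (\<phi> has_derivative blinfun_apply (\<phi>' u)) (at u)"
    and inj_derivative: "u \<in> U \<Longrightarrow> inj (blinfun_apply (\<phi>' u))"
    and lipschitz_derivative: "u \<in> U \<Longrightarrow> \<exists>e>0. \<exists>L. lipschitz_on L (U \<inter> ball u e) \<phi>'"
begin

lemma open_domain: "open U"
  using parametrization by (simp add: local_parametrization_def)

lemma continuous_on_derivative: "continuous_on U \<phi>'"
proof (rule continuous_at_imp_continuous_on, rule ballI)
  fix u assume "u \<in> U"
  obtain e L where e: "e > 0" "lipschitz_on L (U \<inter> ball u e) \<phi>'"
    using lipschitz_derivative[OF \<open>u \<in> U\<close>] by blast
  have "continuous_on (U \<inter> ball u e) \<phi>'"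
    by (rule lipschitz_on_continuous_on[OF e(2)])
  then show "isCont \<phi>' u"
    using e(1) \<open>u \<in> U\<close> open_domain by (simp add: continuous_on_eq_continuous_at open_Int)
qed

lemma continuous_on_parametrization: "continuous_on U \<phi>"
  using has_derivative has_derivative_continuous continuous_at_imp_continuous_on by blast

lemma parametrization_in: "u \<in> U \<Longrightarrow> \<phi> u \<in> \<Sigma>"
  using parametrization openin_imp_subset unfolding local_parametrization_def by blast

lemma range_derivative_subset_tangent_space:
  assumes "u \<in> U"
  shows "range (\<phi>' u) \<subseteq> tangent_space \<Sigma> (\<phi> u)"
proof (rule image_subsetI)
  fix h :: "real ^ 'p::{finite, wellorder}"
  obtain \<epsilon> where \<epsilon>: "\<epsilon> > 0" "ball u \<epsilon> \<subseteq> U"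
    using open_domain assms openE by blast
  define e where "e = \<epsilon> / (norm h + 1)"
  have e: "e > 0" using \<epsilon>(1) by (simp add: e_def add_nonneg_pos)
  have inU: "u + t *\<^sub>R h \<in> U" if "t \<in> {-e<..<e}" for t
  proof -
    have "\<bar>t\<bar> * norm h \<le> \<bar>t\<bar> * (norm h + 1)" by (simp add: mult_left_mono)
    also have "\<dots> < e * (norm h + 1)"
      using that by (intro mult_strict_right_mono) (auto simp: add_nonneg_pos)
    also have "\<dots> = \<epsilon>" by (simp add: e_def add_nonneg_eq_0_iff)
    finally show ?thesis using \<epsilon>(2) by (auto simp: dist_norm subset_iff)
  qed
  define \<gamma> where "\<gamma> = (\<lambda>t. \<phi> (u + t *\<^sub>R h))"
  have deriv: "(\<gamma> has_vector_derivative \<phi>' (u + t *\<^sub>R h) h) (at t)" if "t \<in> {-e<..<e}" for t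
  proof -
    have "((\<lambda>t. u + t *\<^sub>R h) has_derivative (\<lambda>s. s *\<^sub>R h)) (at t)"
      by (auto intro!: derivative_eq_intros)
    from has_derivative_compose[OF this has_derivative[OF inU[OF that]]]
    show ?thesis
      by (simp add: \<gamma>_def has_vector_derivative_def blinfun.scaleR_right)
  qed
  have "continuous_on {-e<..<e} (\<lambda>t. \<phi>' (u + t *\<^sub>R h))"
  proof (rule continuous_on_compose2[OF continuous_on_derivative])
    show "continuous_on {-e<..<e} (\<lambda>t. u + t *\<^sub>R h)" by (intro continuous_intros)
  qed (use inU in blast)
  then have "continuous_on {-e<..<e} (\<lambda>t. \<phi>' (u + t *\<^sub>R h) h)"
    by (rule bounded_linear.continuous_on[OF blinfun.bounded_linear_left])
  then have "\<gamma> C1_differentiable_on {-e<..<e}"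
    unfolding C1_differentiable_on_def
    by (intro exI[of _ "\<lambda>t. \<phi>' (u + t *\<^sub>R h) h"] conjI ballI deriv)
  moreover have "\<gamma> ` {-e<..<e} \<subseteq> \<Sigma>"
    using inU parametrization_in by (auto simp: \<gamma>_def)
  moreover have "\<gamma> 0 = \<phi> u" "(\<gamma> has_vector_derivative \<phi>' u h) (at 0)"
    using deriv[of 0] e by (auto simp: \<gamma>_def)
  ultimately show "\<phi>' u h \<in> tangent_space \<Sigma> (\<phi> u)"
    unfolding tangent_space_def using e by blast
qed

text \<open>Let \<open>s = \<psi> \<circ> \<gamma>\<close> be the curve seen in the chart. It is only known to be continuous, but since \<open>\<phi>' u\<close>
  is bounded below, the expansion of \<open>\<phi>\<close> at \<open>u\<close> gives \<open>\<bar>s t - u\<bar> = O(\<bar>t\<bar>)\<close>. Hence \<open>v\<close> is a limit of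
  the vectors \<open>\<phi>' u ((s t - u) / t)\<close>, which lie in a closed subspace.\<close>

lemma tangent_space_subset_range_derivative:
  assumes u: "u \<in> U"
  shows "tangent_space \<Sigma> (\<phi> u) \<subseteq> range (\<phi>' u)"
proof
  fix v assume "v \<in> tangent_space \<Sigma> (\<phi> u)"
  then obtain \<gamma> e where e: "e > 0" and C1: "\<gamma> C1_differentiable_on {-e<..<e}"
    and sub: "\<gamma> ` {-e<..<e} \<subseteq> \<Sigma>" and \<gamma>0: "\<gamma> 0 = \<phi> u"
    and D: "(\<gamma> has_vector_derivative v) (at 0)"
    unfolding tangent_space_def by blast
  obtain \<psi> where \<psi>: "homeomorphism U (\<phi> ` U) \<phi> \<psi>"
    using parametrization by (auto simp: local_parametrization_def)
  obtain W where W: "open W" "\<phi> ` U = \<Sigma> \<inter> W"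
    using parametrization by (auto simp: local_parametrization_def openin_open)
  have \<psi>\<phi>: "\<psi> (\<phi> w) = w" if "w \<in> U" for w
    using \<psi> that by (simp add: homeomorphism_def)
  have \<phi>\<psi>: "\<phi> (\<psi> y) = y" if "y \<in> \<phi> ` U" for y
    using \<psi> that by (auto simp: homeomorphism_def)
  have \<psi>U: "\<psi> y \<in> U" if "y \<in> \<phi> ` U" for y
    using \<psi> that by (auto simp: homeomorphism_def)
  obtain B where B: "B > 0" "\<And>h. B * norm h \<le> norm (\<phi>' u h)"
    using linear_inj_bounded_below_pos[of "blinfun_apply (\<phi>' u)"] inj_derivative[OF u]
    by (metis blinfun.bounded_linear_right bounded_linear.linear)
  have cont: "isCont \<gamma> 0"
    using D has_vector_derivative_continuous by blast
  define s where "s = (\<lambda>t. \<psi> (\<gamma> t))"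
  have in_image: "eventually (\<lambda>t. \<gamma> t \<in> \<phi> ` U) (at 0)"
  proof -
    have "(\<gamma> \<longlongrightarrow> \<phi> u) (at 0)" using cont \<gamma>0 by (simp add: isCont_def)
    moreover have "\<phi> u \<in> W" using u W by blast
    ultimately have "eventually (\<lambda>t. \<gamma> t \<in> W) (at 0)"
      using W(1) topological_tendstoD by blast
    moreover have "eventually (\<lambda>t. t \<in> {-e<..<e}) (at 0)"
      using e by (intro eventually_at_in_open') auto
    ultimately show ?thesis
      by eventually_elim (use sub W in blast)
  qed
  have s_tendsto: "(s \<longlongrightarrow> u) (at 0)"
  proof -
    have "continuous_on (\<phi> ` U) \<psi>" using \<psi> by (simp add: homeomorphism_def)
    moreover have "(\<gamma> \<longlongrightarrow> \<phi> u) (at 0)" using cont \<gamma>0 by (simp add: isCont_def)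
    ultimately have "(s \<longlongrightarrow> \<psi> (\<phi> u)) (at 0)"
      unfolding s_def by (rule continuous_on_tendsto_compose) (use u in_image in auto)
    then show ?thesis using \<psi>\<phi>[OF u] by simp
  qed
  \<comment> \<open>\<open>\<epsilon> \<le> B / 2\<close> allows the error \<open>\<epsilon> \<bar>s t - u\<bar>\<close> to be absorbed into \<open>B \<bar>s t - u\<bar>\<close>\<close>
  have close: "\<exists>w \<in> range (\<phi>' u). dist w v \<le> \<epsilon> * (1 + 2 * (norm v + 1) / B)"
    if \<epsilon>: "0 < \<epsilon>" "\<epsilon> \<le> 1" "\<epsilon> \<le> B / 2" for \<epsilon>
  proof -
    have "eventually (\<lambda>t. norm (\<gamma> t - \<phi> u - t *\<^sub>R v) \<le> \<epsilon> * \<bar>t\<bar>) (at 0)"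
    proof -
      obtain d where d: "d > 0" "\<And>t. norm (t - 0) < d \<Longrightarrow>
          norm (\<gamma> t - \<gamma> 0 - (t - 0) *\<^sub>R v) \<le> \<epsilon> * norm (t - 0)"
        using D \<epsilon>(1) unfolding has_vector_derivative_def has_derivative_at_alt by metis
      show ?thesis
        unfolding eventually_at using d \<gamma>0 by (intro exI[of _ d]) auto
    qed
    moreover have "eventually (\<lambda>t. norm (\<phi> (s t) - \<phi> u - \<phi>' u (s t - u)) \<le> \<epsilon> * norm (s t - u)) (at 0)"
    proof -
      obtain d where d: "d > 0" "\<And>w. norm (w - u) < d \<Longrightarrow>
          norm (\<phi> w - \<phi> u - \<phi>' u (w - u)) \<le> \<epsilon> * norm (w - u)"
        using has_derivative[OF u] \<epsilon>(1) unfolding has_derivative_at_alt by metis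
      have "eventually (\<lambda>t. dist (s t) u < d) (at 0)"
        using s_tendsto d(1) tendstoD by blast
      then show ?thesis by eventually_elim (use d in \<open>simp add: dist_norm\<close>)
    qed
    moreover have "eventually (\<lambda>t :: real. t \<noteq> 0) (at 0)"
      by (simp add: eventually_at_filter)
    ultimately have ev: "eventually (\<lambda>t. \<gamma> t \<in> \<phi> ` U \<and> t \<noteq> 0 \<and>
        norm (\<gamma> t - \<phi> u - t *\<^sub>R v) \<le> \<epsilon> * \<bar>t\<bar> \<and>
        norm (\<phi> (s t) - \<phi> u - \<phi>' u (s t - u)) \<le> \<epsilon> * norm (s t - u)) (at 0)"
      using in_image by eventually_elim auto
    obtain t where t: "\<gamma> t \<in> \<phi> ` U" "t \<noteq> 0"
        "norm (\<gamma> t - \<phi> u - t *\<^sub>R v) \<le> \<epsilon> * \<bar>t\<bar>"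
        "norm (\<phi> (s t) - \<phi> u - \<phi>' u (s t - u)) \<le> \<epsilon> * norm (s t - u)"
      using eventually_happens'[OF at_neq_bot ev] by blast
    have \<phi>s: "\<phi> (s t) = \<gamma> t" using t(1) \<phi>\<psi> by (simp add: s_def)
    define n where "n = norm (s t - u)"
    have "B * n \<le> norm (\<phi>' u (s t - u))" unfolding n_def by (rule B)
    also have "\<dots> = norm ((\<gamma> t - \<phi> u - t *\<^sub>R v) + t *\<^sub>R v - (\<gamma> t - \<phi> u - \<phi>' u (s t - u)))"
      by simp
    also have "\<dots> \<le> norm (\<gamma> t - \<phi> u - t *\<^sub>R v) + norm (t *\<^sub>R v)
        + norm (\<gamma> t - \<phi> u - \<phi>' u (s t - u))"
      by (intro order_trans[OF norm_triangle_ineq4] add_right_mono norm_triangle_ineq)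
    also have "\<dots> \<le> \<epsilon> * \<bar>t\<bar> + \<bar>t\<bar> * norm v + \<epsilon> * n"
      using t(3,4) by (simp add: \<phi>s n_def)
    also have "\<dots> \<le> 1 * \<bar>t\<bar> + \<bar>t\<bar> * norm v + B / 2 * n"
      using \<epsilon> by (intro add_mono mult_right_mono) (auto simp: n_def)
    finally have n: "n \<le> \<bar>t\<bar> * (2 * (norm v + 1) / B)"
      using B(1) by (simp add: field_simps)
    have "norm (t *\<^sub>R v - \<phi>' u (s t - u))
        = norm ((\<gamma> t - \<phi> u - \<phi>' u (s t - u)) - (\<gamma> t - \<phi> u - t *\<^sub>R v))" by simp
    also have "\<dots> \<le> norm (\<gamma> t - \<phi> u - \<phi>' u (s t - u)) + norm (\<gamma> t - \<phi> u - t *\<^sub>R v)"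
      by (rule norm_triangle_ineq4)
    also have "\<dots> \<le> \<epsilon> * n + \<epsilon> * \<bar>t\<bar>"
      using t(3,4) by (simp add: \<phi>s n_def)
    also have "\<dots> \<le> \<epsilon> * (\<bar>t\<bar> * (2 * (norm v + 1) / B)) + \<epsilon> * \<bar>t\<bar>"
      using n \<epsilon> by (intro add_mono mult_left_mono) auto
    also have "\<dots> = \<bar>t\<bar> * (\<epsilon> * (1 + 2 * (norm v + 1) / B))" by (simp add: algebra_simps)
    finally have *: "norm (t *\<^sub>R v - \<phi>' u (s t - u)) \<le> \<bar>t\<bar> * (\<epsilon> * (1 + 2 * (norm v + 1) / B))" .
    have "\<bar>t\<bar> * dist (\<phi>' u ((s t - u) /\<^sub>R t)) v = norm (t *\<^sub>R (\<phi>' u ((s t - u) /\<^sub>R t) - v))"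
      by (simp add: dist_norm)
    also have "\<dots> = norm (t *\<^sub>R v - \<phi>' u (s t - u))"
    proof -
      have "t *\<^sub>R \<phi>' u ((s t - u) /\<^sub>R t) = \<phi>' u (s t - u)"
        using t(2) by (simp flip: blinfun.scaleR_right)
      then show ?thesis by (simp add: scaleR_diff_right norm_minus_commute)
    qed
    finally have "dist (\<phi>' u ((s t - u) /\<^sub>R t)) v \<le> \<epsilon> * (1 + 2 * (norm v + 1) / B)"
      using * t(2) by (metis mult_le_cancel_left_pos zero_less_abs_iff)
    then show ?thesis by blast
  qed
  have "v \<in> closure (range (\<phi>' u))"
    unfolding closure_approachable
  proof (intro allI impI)
    fix \<delta> :: real assume \<delta>: "\<delta> > 0"
    define K where "K = 1 + 2 * (norm v + 1) / B"
    have K: "K > 0" using B(1) by (simp add: K_def add_pos_nonneg)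
    define \<epsilon> where "\<epsilon> = min (\<delta> / (2 * K)) (min 1 (B / 2))"
    have "0 < \<epsilon>" "\<epsilon> \<le> 1" "\<epsilon> \<le> B / 2" using \<delta> K B(1) by (auto simp: \<epsilon>_def)
    then obtain w where w: "w \<in> range (\<phi>' u)" "dist w v \<le> \<epsilon> * K"
      using close unfolding K_def by blast
    have "\<epsilon> * K \<le> \<delta> / (2 * K) * K" using K by (intro mult_right_mono) (auto simp: \<epsilon>_def)
    also have "\<dots> < \<delta>" using K \<delta> by simp
    finally show "\<exists>w\<in>range (\<phi>' u). dist w v < \<delta>" using w(2) by (intro bexI[OF _ w(1)]) linarith
  qed
  moreover have "closed (range (\<phi>' u))"
    by (intro closed_subspace linear_subspace_image)
       (auto simp: blinfun.bounded_linear_right bounded_linear.linear)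
  ultimately show "v \<in> range (\<phi>' u)" by simp
qed

lemma tangent_space_eq: "u \<in> U \<Longrightarrow> tangent_space \<Sigma> (\<phi> u) = range (\<phi>' u)"
  using range_derivative_subset_tangent_space tangent_space_subset_range_derivative by blast

end

section \<open>The degree in terms of the minors of a chart\<close>

text \<open>The maximum defining the degree of \<open>\<Sigma>\<close> is over a finite set, as every pointwise degree is \<open>Max\<close> of
  a set of weights of index tuples.\<close>

lemma pointwise_degree_le_submanifold_degree:
  assumes "y \<in> \<Sigma>"
  shows "pointwise_degree TYPE('p::finite) \<Sigma> y \<le> submanifold_degree TYPE('p) \<Sigma>"
proof -
  let ?W = "range (\<lambda>s :: 'p \<Rightarrow> 4. \<Sum>j\<in>UNIV. engel_weight (s j))"
  have "pointwise_degree TYPE('p) \<Sigma> z \<in> Max ` Pow ?W" for z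
    unfolding pointwise_degree_def wedge_degree_def setcompr_eq_image by blast
  then have "pointwise_degree TYPE('p) \<Sigma> ` \<Sigma> \<subseteq> Max ` Pow ?W"
    by (rule image_subsetI)
  then have "finite (pointwise_degree TYPE('p) \<Sigma> ` \<Sigma>)"
    by (rule finite_subset) simp
  then show ?thesis
    unfolding submanifold_degree_def using assms by (intro Max_ge) auto
qed

context c11_chart
begin

definition frame where
  "frame u = (\<chi> j. \<phi>' u (axis j 1))"

lemma frame_basis:
  assumes "u \<in> U"
  shows "is_basis_of (frame u) (tangent_space \<Sigma> (\<phi> u))"
proof -
  have lin: "linear (\<phi>' u)" by (simp add: blinfun.bounded_linear_right bounded_linear.linear)
  have range: "range (\<lambda>j. frame u $ j) = \<phi>' u ` Basis"
    by (auto simp: frame_def Basis_vec_def image_iff)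
  have "inj (\<lambda>j. frame u $ j)"
    using inj_derivative[OF assms]
    by (intro injI) (auto simp: frame_def axis_eq_axis dest: injD)
  moreover have "independent (\<phi>' u ` Basis)"
    using linear_independent_injective_image[OF lin independent_Basis] inj_derivative[OF assms]
    by simp
  moreover have "span (\<phi>' u ` Basis) = range (\<phi>' u)"
    using linear_span_image[OF lin, of Basis] by simp
  ultimately show ?thesis
    by (simp add: is_basis_of_def range tangent_space_eq[OF assms])
qed

lemma pointwise_degree_eq:
  assumes "u \<in> U"
  shows "pointwise_degree TYPE('p) \<Sigma> (\<phi> u) = wedge_degree (\<phi> u) (frame u)"
proof -
  have "\<exists>v :: real ^ 4 ^ 'p::{finite, wellorder}. is_basis_of v (tangent_space \<Sigma> (\<phi> u))"
    using frame_basis[OF assms] by blast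
  then have "is_basis_of (SOME v :: real ^ 4 ^ 'p::{finite, wellorder}.
      is_basis_of v (tangent_space \<Sigma> (\<phi> u))) (tangent_space \<Sigma> (\<phi> u))"
    by (rule someI_ex)
  from wedge_degree_basis_independent[OF this frame_basis[OF assms]] show ?thesis
    unfolding pointwise_degree_def .
qed

text \<open>This turns an upper bound on the degree into equations between the rows of the differential.\<close>

lemma wedge_coeff_eq_0:
  assumes "u \<in> U" "pointwise_degree TYPE('p) \<Sigma> (\<phi> u) < (\<Sum>j\<in>UNIV. engel_weight (s j))"
  shows "wedge_coeff (\<phi> u) (frame u) s = 0"
proof (rule ccontr)
  assume nz: "wedge_coeff (\<phi> u) (frame u) s \<noteq> 0"
  let ?W = "{\<Sum>j\<in>UNIV. engel_weight (s j) | s. wedge_coeff (\<phi> u) (frame u) s \<noteq> 0}"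
  have "finite ?W"
    unfolding setcompr_eq_image by (rule finite_imageI) simp
  moreover have "(\<Sum>j\<in>UNIV. engel_weight (s j)) \<in> ?W"
    unfolding mem_Collect_eq by (rule exI[of _ s], rule conjI[OF refl nz])
  ultimately have "(\<Sum>j\<in>UNIV. engel_weight (s j)) \<le> Max ?W" by (rule Max_ge)
  moreover have "pointwise_degree TYPE('p) \<Sigma> (\<phi> u) = Max ?W"
    unfolding pointwise_degree_eq[OF assms(1)] wedge_degree_def ..
  ultimately show False
    using assms(2) by linarith
qed

text \<open>The rows of the differential of the chart in the left invariant frame at \<open>\<phi> u\<close>, denoted \<open>\<theta>\<^sub>i\<close> in the
  introduction.\<close>

definition tangent_coord where
  "tangent_coord u i h = engel_coords (\<phi> u) (\<phi>' u h) $ i"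

lemma linear_tangent_coord: "linear (tangent_coord u i)"
  unfolding tangent_coord_def
  by (rule linear_compose[OF _ linear_engel_coords_nth, unfolded o_def])
     (simp add: blinfun.bounded_linear_right bounded_linear.linear)

lemma tangent_coord_basis: "tangent_coord u i h = (\<Sum>k\<in>UNIV. h $ k * tangent_coord u i (axis k 1))"
proof -
  have "tangent_coord u i h = tangent_coord u i (\<Sum>k\<in>UNIV. h $ k *\<^sub>R axis k 1)"
    using basis_expansion[of h] by (simp add: scalar_mult_eq_scaleR)
  then show ?thesis
    by (simp add: linear_sum[OF linear_tangent_coord] linear_scale[OF linear_tangent_coord])
qed

lemma tangent_coords_eq_0_imp:
  assumes "u \<in> U" "\<And>i. tangent_coord u i h = 0"
  shows "h = 0"
proof -
  have "engel_coords (\<phi> u) (\<phi>' u h) = 0"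
    using assms(2) by (simp add: vec_eq_iff tangent_coord_def)
  then have "\<phi>' u h = \<phi>' u 0" by (simp add: engel_coords_eq_0_iff)
  then show ?thesis by (rule injD[OF inj_derivative[OF assms(1)]])
qed

lemma wedge_coeff_frame:
  "wedge_coeff (\<phi> u) (frame u) s = det (\<chi> i j. tangent_coord u (s j) (axis i 1))"
  by (simp add: wedge_coeff_def frame_def tangent_coord_def)

lemma tangent_coord_eq_0_curve:
  assumes card: "CARD('p) = 1" and u: "u \<in> U"
    and deg: "pointwise_degree TYPE('p) \<Sigma> (\<phi> u) < engel_weight i"
  shows "tangent_coord u i h = 0"
proof -
  obtain a :: 'p where a: "UNIV = {a}"
    using card by (metis One_nat_def card_1_singleton_iff)
  have "wedge_coeff (\<phi> u) (frame u) (\<lambda>_. i) = 0"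
    using deg card by (intro wedge_coeff_eq_0[OF u]) simp
  then have "tangent_coord u i (axis a 1) = 0"
    by (simp add: wedge_coeff_frame det_UNIV_singleton[OF a])
  then show ?thesis
    using tangent_coord_basis[of u i h] by (simp add: a)
qed

text \<open>The difference of the two sides is the minor of the rows \<open>i\<close>, \<open>j\<close> times the determinant of \<open>h\<close>, \<open>k\<close>.\<close>

lemma tangent_coords_proportional_surface:
  assumes card: "CARD('p) = 2" and u: "u \<in> U"
    and deg: "pointwise_degree TYPE('p) \<Sigma> (\<phi> u) < engel_weight i + engel_weight j"
  shows "tangent_coord u i h * tangent_coord u j k = tangent_coord u i k * tangent_coord u j h"
proof -
  obtain a b :: 'p where ab: "UNIV = {a, b}" "a \<noteq> b"
    using card unfolding card_2_iff by metis
  have "wedge_coeff (\<phi> u) (frame u) (\<lambda>l. if l = a then i else j) = 0"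
    using deg ab by (intro wedge_coeff_eq_0[OF u]) (simp add: ab(1))
  then have "tangent_coord u i (axis a 1) * tangent_coord u j (axis b 1)
      = tangent_coord u j (axis a 1) * tangent_coord u i (axis b 1)"
    using ab(2) by (simp add: wedge_coeff_frame det_UNIV_doubleton[OF ab])
  then have minor: "tangent_coord u i (axis a 1) * tangent_coord u j (axis b 1)
      - tangent_coord u j (axis a 1) * tangent_coord u i (axis b 1) = 0" by simp
  have expand: "tangent_coord u l v = v $ a * tangent_coord u l (axis a 1)
      + v $ b * tangent_coord u l (axis b 1)" for l v
    unfolding tangent_coord_basis[of u l v] using ab by (simp add: ab(1))
  have "tangent_coord u i h * tangent_coord u j k - tangent_coord u i k * tangent_coord u j h
    = (h $ a * k $ b - h $ b * k $ a) * (tangent_coord u i (axis a 1) * tangent_coord u j (axis b 1)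
      - tangent_coord u j (axis a 1) * tangent_coord u i (axis b 1))"
    unfolding expand[of i h] expand[of i k] expand[of j h] expand[of j k]
    by (simp only: algebra_simps)
  then show ?thesis unfolding minor by simp
qed

text \<open>If row \<open>i\<close> did not vanish on \<open>h\<close>, then all other rows would be multiples of it. The vector
  \<open>\<theta>\<^sub>i h k - \<theta>\<^sub>i k h\<close> would be in the kernel of the differential for every \<open>k\<close>, so that every \<open>k\<close> would be
  a multiple of \<open>h\<close>, which is impossible in dimension two.\<close>

lemma tangent_coord_eq_0_surface:
  assumes card: "CARD('p) = 2" and u: "u \<in> U"
    and deg: "\<And>j. j \<noteq> i \<Longrightarrow> pointwise_degree TYPE('p) \<Sigma> (\<phi> u) < engel_weight i + engel_weight j"
  shows "tangent_coord u i h = 0"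
proof (rule ccontr)
  assume nz: "tangent_coord u i h \<noteq> 0"
  obtain a b :: 'p where ab: "UNIV = {a, b}" "a \<noteq> b"
    using card unfolding card_2_iff by metis
  have parallel: "tangent_coord u i h *\<^sub>R k = tangent_coord u i k *\<^sub>R h" for k
  proof -
    have "tangent_coord u j (tangent_coord u i h *\<^sub>R k - tangent_coord u i k *\<^sub>R h) = 0" for j
    proof -
      have "tangent_coord u i h * tangent_coord u j k = tangent_coord u i k * tangent_coord u j h"
        using tangent_coords_proportional_surface[OF card u deg[of j]] by (cases "j = i") auto
      then show ?thesis
        by (simp add: linear_diff[OF linear_tangent_coord] linear_scale[OF linear_tangent_coord])
    qed
    then show ?thesis using tangent_coords_eq_0_imp[OF u] by fastforce
  qed
  have "tangent_coord u i h = tangent_coord u i (axis a 1) * h $ a"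
    using arg_cong[OF parallel[of "axis a 1"], of "\<lambda>v. v $ a"] by simp
  moreover have "tangent_coord u i h = tangent_coord u i (axis b 1) * h $ b"
    using arg_cong[OF parallel[of "axis b 1"], of "\<lambda>v. v $ b"] by simp
  moreover have "0 = tangent_coord u i (axis a 1) * h $ b"
    using arg_cong[OF parallel[of "axis a 1"], of "\<lambda>v. v $ b"] ab(2) by (simp add: axis_def)
  ultimately show False using nz by auto
qed

section \<open>The Riemannian Jacobian of a chart\<close>

lemma riemannian_jacobian_eq:
  assumes "u \<in> U"
  shows "riemannian_jacobian \<phi> u =
    sqrt (det (\<chi> i j. engel_coords (\<phi> u) (frame u $ i) \<bullet> engel_coords (\<phi> u) (frame u $ j)))"
  using frechet_derivative_at[OF has_derivative[OF assms]]
  by (simp add: riemannian_jacobian_def engel_metric_def frame_def)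

lemma continuous_on_riemannian_jacobian: "continuous_on U (riemannian_jacobian \<phi>)"
proof -
  have D: "continuous_on U (\<lambda>u. \<phi>' u h $ i)" for h i
    by (intro continuous_on_component bounded_linear.continuous_on[OF blinfun.bounded_linear_left]
        continuous_on_derivative)
  have P: "continuous_on U (\<lambda>u. \<phi> u $ i)" for i
    by (intro continuous_on_component continuous_on_parametrization)
  have "\<forall>i. continuous_on U (\<lambda>u. engel_coords (\<phi> u) (frame u $ j) $ i)" for j
    unfolding forall_4 engel_coords_eq vector_4 frame_def vec_lambda_beta
    by (intro conjI continuous_on_add continuous_on_diff continuous_on_mult continuous_on_divide
        continuous_on_power continuous_on_const D P) auto
  then have C: "continuous_on U (\<lambda>u. engel_coords (\<phi> u) (frame u $ j) $ i)" for i j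
    by blast
  have "continuous_on U (\<lambda>u. sqrt (det (\<chi> i j. engel_coords (\<phi> u) (frame u $ i) \<bullet>
      engel_coords (\<phi> u) (frame u $ j))))"
    unfolding inner_vec_def inner_real_def
    by (intro continuous_on_real_sqrt continuous_on_det)
       (simp add: continuous_on_sum continuous_on_mult C)
  then show ?thesis
    by (simp add: riemannian_jacobian_eq cong: continuous_on_cong)
qed

lemma riemannian_jacobian_pos:
  assumes "u \<in> U"
  shows "riemannian_jacobian \<phi> u > 0"
proof -
  have "det (\<chi> i j. engel_coords (\<phi> u) (frame u $ i) \<bullet> engel_coords (\<phi> u) (frame u $ j)) > 0"
  proof (rule gram_det_pos)
    fix z :: "real ^ 'p::{finite, wellorder}"
    assume 0: "(\<Sum>i\<in>UNIV. (z $ i) *\<^sub>R engel_coords (\<phi> u) (frame u $ i)) = 0"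
    have "(\<Sum>i\<in>UNIV. (z $ i) *\<^sub>R engel_coords (\<phi> u) (frame u $ i))
        = engel_coords (\<phi> u) (\<phi>' u (\<Sum>i\<in>UNIV. (z $ i) *\<^sub>R axis i 1))"
      by (simp add: frame_def blinfun.sum_right blinfun.scaleR_right
          linear_sum[OF linear_engel_coords] linear_scale[OF linear_engel_coords])
    also have "(\<Sum>i\<in>UNIV. (z $ i) *\<^sub>R axis i 1) = z"
      using basis_expansion[of z] by (simp add: scalar_mult_eq_scaleR)
    finally have "\<phi>' u z = \<phi>' u 0"
      using 0 by (simp add: engel_coords_eq_0_iff)
    then show "z = 0" by (rule injD[OF inj_derivative[OF assms]])
  qed
  then show ?thesis by (simp add: riemannian_jacobian_eq[OF assms])
qed

section \<open>Taylor estimates in a chart\<close>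

text \<open>The \<open>C\<^sup>1\<^sup>,\<^sup>1\<close> regularity enters here. One constant serves for all four estimates, which are
  written in the left invariant frame of a fixed point \<open>x\<close>.\<close>

lemma quadratic_remainder:
  assumes u: "u \<in> U"
  obtains \<delta> C where "\<delta> > 0" "C \<ge> 0" "ball u \<delta> \<subseteq> U"
    "\<And>v h i. norm v < \<delta> \<Longrightarrow>
       \<bar>engel_coords x (\<phi>' (u + v) h) $ i - engel_coords x (\<phi>' u h) $ i\<bar> \<le> C * norm v * norm h"
    "\<And>v i. norm v < \<delta> \<Longrightarrow>
       \<bar>engel_coords x (\<phi> (u + v) - \<phi> u) $ i - engel_coords x (\<phi>' u v) $ i\<bar> \<le> C * (norm v)\<^sup>2"
    "\<And>v i. norm v < \<delta> \<Longrightarrow> \<bar>engel_coords x (\<phi> (u + v) - \<phi> u) $ i\<bar> \<le> C * norm v"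
    "\<And>h i. \<bar>engel_coords x (\<phi>' u h) $ i\<bar> \<le> C * norm h"
proof -
  obtain e L where e: "e > 0" and L: "lipschitz_on L (U \<inter> ball u e) \<phi>'"
    using lipschitz_derivative[OF u] by blast
  have L0: "L \<ge> 0" using L by (rule lipschitz_on_nonneg)
  obtain e' where e': "e' > 0" "ball u e' \<subseteq> U"
    using open_domain u openE by blast
  define \<delta> where "\<delta> = min 1 (min e e')"
  have \<delta>: "\<delta> > 0" "\<delta> \<le> 1" "ball u \<delta> \<subseteq> U \<inter> ball u e" using e e' by (auto simp: \<delta>_def)
  obtain K where K: "K \<ge> 0" "\<And>w. norm (engel_coords x w) \<le> norm w * K"
    using bounded_linear.nonneg_bounded[OF bounded_linear_engel_coords] by blast
  have lip: "norm (\<phi>' (u + v) - \<phi>' u) \<le> L * norm v" if "norm v < \<delta>" for v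
  proof -
    have "u + v \<in> ball u \<delta>" using that by (simp add: dist_norm)
    then have "u + v \<in> U \<inter> ball u e" using \<delta>(3) by blast
    then show ?thesis
      using lipschitz_onD[OF L, of "u + v" u] u e by (simp add: dist_norm)
  qed
  have taylor: "norm (\<phi> (u + v) - \<phi> u - \<phi>' u v) \<le> L * (norm v)\<^sup>2" if v: "norm v < \<delta>" for v
  proof -
    have "norm (\<phi> (u + v) - \<phi> u - \<phi>' u (u + v - u)) \<le> norm (u + v - u) * (L * norm v)"
    proof (rule differentiable_bound_linearization[where S = "cball u (norm v)" and f' = "\<lambda>w. blinfun_apply (\<phi>' w)"])
      show "u + t *\<^sub>R (u + v - u) \<in> cball u (norm v)" if "t \<in> {0..1}" for t
        using that by (auto simp: dist_norm mult_left_le_one_le)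
      fix w assume "w \<in> cball u (norm v)"
      then have w: "norm (w - u) \<le> norm v" by (simp add: dist_norm norm_minus_commute)
      then have "w \<in> U" using v \<delta>(3) by (auto simp: dist_norm norm_minus_commute subset_iff)
      then show "(\<phi> has_derivative \<phi>' w) (at w within cball u (norm v))"
        using has_derivative has_derivative_at_withinI by blast
      have "onorm (blinfun_apply (\<phi>' w) - blinfun_apply (\<phi>' u)) = norm (\<phi>' w - \<phi>' u)"
        by (simp add: norm_blinfun.rep_eq minus_blinfun.rep_eq fun_diff_def)
      also have "\<dots> \<le> L * norm (w - u)" using lip[of "w - u"] w v by simp
      also have "\<dots> \<le> L * norm v" using w L0 by (rule mult_left_mono)
      finally show "onorm (blinfun_apply (\<phi>' w) - blinfun_apply (\<phi>' u)) \<le> L * norm v" .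
    qed simp
    then show ?thesis by (simp add: power2_eq_square algebra_simps)
  qed
  have coord: "\<bar>engel_coords x w $ i\<bar> \<le> K * B" if "norm w \<le> B" for w i B
  proof -
    have "\<bar>engel_coords x w $ i\<bar> \<le> norm (engel_coords x w)" by (rule component_le_norm_cart)
    also have "\<dots> \<le> K * norm w" using K(2)[of w] by (simp add: mult.commute)
    also have "\<dots> \<le> K * B" using that K(1) by (rule mult_left_mono)
    finally show ?thesis .
  qed
  have coords_diff: "engel_coords x (a - b) $ i = engel_coords x a $ i - engel_coords x b $ i" for a b i
    by (rule linear_diff[OF linear_engel_coords_nth])
  define C where "C = K * (L + norm (\<phi>' u))"
  show thesis
  proof (rule that[of \<delta> C])
    show "\<delta> > 0" "ball u \<delta> \<subseteq> U" using \<delta> by auto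
    show "C \<ge> 0" using K L0 by (simp add: C_def)
    fix i
    show "\<bar>engel_coords x (\<phi>' u h) $ i\<bar> \<le> C * norm h" for h
    proof -
      have "norm (\<phi>' u h) \<le> (L + norm (\<phi>' u)) * norm h"
        using norm_blinfun[of "\<phi>' u" h] L0 by (simp add: distrib_right add_increasing)
      from coord[OF this, of i] show ?thesis by (simp add: C_def mult.assoc)
    qed
    fix v :: "real ^ 'p::{finite, wellorder}" assume v: "norm v < \<delta>"
    show "\<bar>engel_coords x (\<phi>' (u + v) h) $ i - engel_coords x (\<phi>' u h) $ i\<bar> \<le> C * norm v * norm h" for h
    proof -
      have "norm (\<phi>' (u + v) h - \<phi>' u h) \<le> norm (\<phi>' (u + v) - \<phi>' u) * norm h"
        by (metis blinfun.diff_left norm_blinfun)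
      also have "\<dots> \<le> (L * norm v) * norm h" using lip[OF v] by (intro mult_right_mono) auto
      also have "\<dots> \<le> ((L + norm (\<phi>' u)) * norm v) * norm h" by (intro mult_right_mono) auto
      finally show ?thesis using coord[of "\<phi>' (u + v) h - \<phi>' u h" _ i] by (simp add: C_def mult.assoc coords_diff)
    qed
    show "\<bar>engel_coords x (\<phi> (u + v) - \<phi> u) $ i - engel_coords x (\<phi>' u v) $ i\<bar> \<le> C * (norm v)\<^sup>2"
    proof -
      have "norm (\<phi> (u + v) - \<phi> u - \<phi>' u v) \<le> (L + norm (\<phi>' u)) * (norm v)\<^sup>2"
        using taylor[OF v] by (simp add: distrib_right add_increasing2)
      from coord[OF this, of i] show ?thesis by (simp add: C_def mult.assoc coords_diff)
    qed
    show "\<bar>engel_coords x (\<phi> (u + v) - \<phi> u) $ i\<bar> \<le> C * norm v"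
    proof -
      have "norm (\<phi> (u + v) - \<phi> u) \<le> norm (\<phi> (u + v) - \<phi> u - \<phi>' u v) + norm (\<phi>' u v)"
        using norm_triangle_ineq[of "\<phi> (u + v) - \<phi> u - \<phi>' u v" "\<phi>' u v"] by simp
      also have "\<dots> \<le> L * (norm v)\<^sup>2 + norm (\<phi>' u) * norm v"
        by (intro add_mono taylor v norm_blinfun)
      also have "\<dots> \<le> L * norm v + norm (\<phi>' u) * norm v"
        using v \<delta>(2) L0 by (intro add_right_mono mult_left_mono)
          (auto simp: power2_eq_square mult_left_le_one_le)
      finally have "norm (\<phi> (u + v) - \<phi> u) \<le> (L + norm (\<phi>' u)) * norm v"
        by (simp add: distrib_right)
      from coord[OF this, of i] show ?thesis by (simp add: C_def mult.assoc)
    qed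
  qed
qed

section \<open>Densities from slabs\<close>

text \<open>The hypothesis \<open>box\<close> says that the chart maps the slab of widths \<open>c r^\<alpha>\<close>, \<open>c r^\<beta>\<close> into a box of size
  \<open>M c\<close>. The factor \<open>c\<close> is there to make this box fit into the ball: it is chosen once with
  \<open>M c \<le> \<eta>\<close>, after which the slab has measure of order \<open>r^(\<alpha> (p - 1) + \<beta>)\<close> and the density of the
  surface measure is bounded below on it.\<close>

lemma density_infinite_if_slab:
  fixes e :: "real ^ 'p::{finite, wellorder}"
  assumes \<rho>: "homogeneous_distance \<rho>"
    and \<mu>: "riemannian_surface_measure TYPE('p) \<Sigma> \<mu>"
    and u: "u \<in> U"
    and e: "norm e = 1"
    and \<alpha>\<beta>: "0 < \<alpha>" "\<alpha> \<le> \<beta>" "\<alpha> * real (CARD('p) - 1) + \<beta> < real d"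
    and \<delta>: "\<delta> > 0"
    and box: "\<And>c r v i. \<lbrakk>0 < c; c \<le> 1; 0 < r; r \<le> 1; norm v < \<delta>;
        norm v \<le> c * r powr \<alpha>; \<bar>e \<bullet> v\<bar> \<le> c * r powr \<beta>\<rbrakk> \<Longrightarrow>
        \<bar>engel_coords (\<phi> u) (\<phi> (u + v) - \<phi> u) $ i\<bar> \<le> M * c * r ^ engel_weight i"
  shows "((\<lambda>r. emeasure \<mu> (\<Sigma> \<inter> Metric_space.mcball UNIV \<rho> (\<phi> u) r) / ennreal (r ^ d))
           \<longlongrightarrow> \<infinity>) (at_right 0)"
proof -
  interpret Metric_space UNIV \<rho>
    using \<rho> by (simp add: homogeneous_distance_def)
  obtain \<eta> where \<eta>: "\<eta> > 0" "\<And>x y r. r > 0 \<Longrightarrow>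
      (\<And>i. \<bar>engel_coords x (y - x) $ i\<bar> \<le> \<eta> * r ^ engel_weight i) \<Longrightarrow> \<rho> x y \<le> r"
    using homogeneous_distance_box[OF \<rho>] by metis
  define c where "c = min 1 (\<eta> / (\<bar>M\<bar> + 1))"
  have c: "0 < c" "c \<le> 1" using \<eta>(1) by (auto simp: c_def)
  have Mc: "M * c \<le> \<eta>"
  proof -
    have "M * c \<le> (\<bar>M\<bar> + 1) * c" using c by (intro mult_right_mono) auto
    also have "\<dots> \<le> (\<bar>M\<bar> + 1) * (\<eta> / (\<bar>M\<bar> + 1))" by (intro mult_left_mono) (auto simp: c_def)
    also have "\<dots> = \<eta>" by (simp add: add_nonneg_eq_0_iff)
    finally show ?thesis .
  qed
  define J where "J = riemannian_jacobian \<phi> u / 2"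
  have J: "J > 0" "J < riemannian_jacobian \<phi> u"
    using riemannian_jacobian_pos[OF u] by (simp_all add: J_def)
  have "isCont (riemannian_jacobian \<phi>) u"
    using continuous_on_riemannian_jacobian open_domain u by (simp add: continuous_on_eq_continuous_at)
  then have "eventually (\<lambda>w. riemannian_jacobian \<phi> w > J) (nhds u)"
    using J(2) by (intro order_tendstoD) (auto simp: isCont_def tendsto_at_iff_tendsto_nhds)
  moreover have "eventually (\<lambda>w. w \<in> U) (nhds u)"
    using open_domain u by (rule eventually_nhds_in_open)
  ultimately have "eventually (\<lambda>w. riemannian_jacobian \<phi> w > J \<and> w \<in> U) (nhds u)"
    by eventually_elim auto
  then obtain \<delta>' where \<delta>': "\<delta>' > 0" "\<And>w. dist w u < \<delta>' \<Longrightarrow> riemannian_jacobian \<phi> w > J \<and> w \<in> U"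
    unfolding eventually_nhds_metric by blast
  define n where "n = CARD('p::{finite, wellorder})"
  define \<gamma> where "\<gamma> = \<alpha> * real (n - 1) + \<beta>"
  define K where "K = J * c ^ n / real n ^ n"
  have n: "n > 0" by (simp add: n_def)
  have K: "K > 0" using J c n by (simp add: K_def)
  have lower: "ennreal (K * r powr \<gamma> / r ^ d) \<le>
      emeasure \<mu> (\<Sigma> \<inter> mcball (\<phi> u) r) / ennreal (r ^ d)"
    if r: "0 < r" "r \<le> 1" "c * r powr \<alpha> < \<delta>" "c * r powr \<alpha> < \<delta>'" for r
  proof -
    let ?S = "{w. norm (w - u) \<le> c * r powr \<alpha> \<and> \<bar>e \<bullet> (w - u)\<bar> \<le> c * r powr \<beta>}"
    have "closed ?S"
      by (intro closed_Collect_conj closed_Collect_le continuous_intros)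
    then have borel: "?S \<in> sets borel" by (rule borel_closed)
    have in_ball: "riemannian_jacobian \<phi> w > J \<and> w \<in> U" if "w \<in> ?S" for w
      using that r(4) by (intro \<delta>') (auto simp: dist_norm)
    have sub: "\<phi> ` ?S \<subseteq> \<Sigma> \<inter> mcball (\<phi> u) r"
    proof (intro image_subsetI IntI)
      fix w assume w: "w \<in> ?S"
      show "\<phi> w \<in> \<Sigma>" using in_ball[OF w] parametrization_in by blast
      have "\<rho> (\<phi> u) (\<phi> w) \<le> r"
      proof (rule \<eta>(2)[OF r(1)])
        fix i
        have "\<bar>engel_coords (\<phi> u) (\<phi> (u + (w - u)) - \<phi> u) $ i\<bar> \<le> M * c * r ^ engel_weight i"
          using w r c by (intro box) auto
        also have "\<dots> \<le> \<eta> * r ^ engel_weight i"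
          using Mc r by (intro mult_right_mono) auto
        finally show "\<bar>engel_coords (\<phi> u) (\<phi> w - \<phi> u) $ i\<bar> \<le> \<eta> * r ^ engel_weight i" by simp
      qed
      then show "\<phi> w \<in> mcball (\<phi> u) r" by simp
    qed
    have "\<Sigma> \<inter> mcball (\<phi> u) r \<in> sets \<mu>"
      using \<mu> closed_homogeneous_ball[OF \<rho>, of "\<phi> u" r]
      by (auto simp: riemannian_surface_measure_def sets_restrict_space)
    have "ennreal (K * r powr \<gamma>) =
        ennreal J * ennreal (c * r powr \<beta> * (c * r powr \<alpha>) ^ (n - 1) / real n ^ n)"
    proof -
      have "r powr \<gamma> = r powr \<beta> * (r powr \<alpha>) ^ (n - 1)"
        using r by (simp add: \<gamma>_def powr_add powr_power mult.commute)
      moreover have "c ^ n = c * c ^ (n - 1)" using n by (cases n) auto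
      ultimately have "K * r powr \<gamma> = J * (c * r powr \<beta> * (c * r powr \<alpha>) ^ (n - 1) / real n ^ n)"
        by (simp add: K_def power_mult_distrib)
      then show ?thesis using J(1) by (simp only: ennreal_mult' less_imp_le)
    qed
    also have "\<dots> \<le> ennreal J * emeasure lborel ?S"
    proof (rule mult_left_mono)
      have "r powr \<beta> \<le> r powr \<alpha>" using r \<alpha>\<beta> by (intro powr_mono') auto
      then show "ennreal (c * r powr \<beta> * (c * r powr \<alpha>) ^ (n - 1) / real n ^ n) \<le> emeasure lborel ?S"
        unfolding n_def using c by (intro emeasure_slab_ge e) auto
    qed simp
    also have "\<dots> = (\<integral>\<^sup>+ w. ennreal J * indicator ?S w \<partial>lborel)"
      using borel by (simp add: nn_integral_cmult_indicator)
    also have "\<dots> \<le> (\<integral>\<^sup>+ w\<in>?S. ennreal (riemannian_jacobian \<phi> w) \<partial>lborel)"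
    proof (rule nn_integral_mono)
      fix w
      show "ennreal J * indicator ?S w \<le> ennreal (riemannian_jacobian \<phi> w) * indicator ?S w"
      proof (cases "w \<in> ?S")
        case True
        then show ?thesis using in_ball[OF True] by (simp add: ennreal_leI)
      qed simp
    qed
    also have "\<dots> = emeasure \<mu> (\<phi> ` ?S)"
    proof -
      have "?S \<subseteq> U" using in_ball by blast
      from conjunct2[OF \<mu>[unfolded riemannian_surface_measure_def], rule_format,
          OF parametrization borel this]
      show ?thesis by (rule sym)
    qed
    also have "\<dots> \<le> emeasure \<mu> (\<Sigma> \<inter> mcball (\<phi> u) r)"
      by (rule emeasure_mono) fact+
    finally have "ennreal (K * r powr \<gamma>) / ennreal (r ^ d) \<le>
        emeasure \<mu> (\<Sigma> \<inter> mcball (\<phi> u) r) / ennreal (r ^ d)"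
      by (rule divide_right_mono_ennreal)
    then show ?thesis using r K by (simp add: divide_ennreal)
  qed
  have "\<gamma> < real d" using \<alpha>\<beta>(3) by (simp add: \<gamma>_def n_def)
  have "filterlim (\<lambda>r. K * r powr \<gamma> / r ^ d) at_top (at_right 0)"
  proof -
    have "filterlim (\<lambda>r. K * r powr (\<gamma> - real d)) at_top (at_right 0)"
      using K \<open>\<gamma> < real d\<close> by real_asymp
    moreover have "eventually (\<lambda>r. K * r powr (\<gamma> - real d) = K * r powr \<gamma> / r ^ d) (at_right 0)"
      using eventually_at_right_less[of 0]
      by eventually_elim (simp add: powr_diff powr_realpow)
    ultimately show ?thesis by (rule filterlim_mono_eventually[OF _ order_refl order_refl])
  qed
  then have top: "((\<lambda>r. ennreal (K * r powr \<gamma> / r ^ d)) \<longlongrightarrow> \<infinity>) (at_right 0)"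
    by (simp add: ennreal_tendsto_top_eq_at_top)
  have small: "eventually (\<lambda>r. c * r powr \<alpha> < \<epsilon>) (at_right 0)" if "\<epsilon> > 0" for \<epsilon>
  proof -
    have "((\<lambda>r. c * r powr \<alpha>) \<longlongrightarrow> 0) (at_right 0)"
      using \<alpha>\<beta>(1) c by real_asymp
    then show ?thesis using that by (rule order_tendstoD)
  qed
  have "eventually (\<lambda>r::real. 0 < r \<and> r \<le> 1) (at_right 0)"
    by (auto simp: eventually_at_right_field intro!: exI[of _ 1])
  then have "eventually (\<lambda>r. ennreal (K * r powr \<gamma> / r ^ d) \<le>
      emeasure \<mu> (\<Sigma> \<inter> mcball (\<phi> u) r) / ennreal (r ^ d)) (at_right 0)"
    using small[OF \<delta>] small[OF \<delta>'(1)] by eventually_elim (use lower in blast)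
  then show ?thesis
    by (intro tendsto_sandwich[OF _ _ top tendsto_const]) auto
qed

section \<open>Three regimes of slabs\<close>

text \<open>On a slab with \<open>\<alpha> = 3 / 2\<close> the quadratic remainders are \<open>O(r\<^sup>3)\<close>, which is small enough in the third
  and fourth coordinates; the linear parts are controlled by the width \<open>r^\<beta>\<close> in the direction \<open>e\<close>. The case
  distinctions in the assumptions on \<open>\<beta>\<close> give the three values \<open>3/2\<close>, \<open>2\<close>, \<open>3\<close>.\<close>

lemma density_infinite_rank_one:
  fixes e :: "real ^ 'p::{finite, wellorder}"
  assumes \<rho>: "homogeneous_distance \<rho>"
    and \<mu>: "riemannian_surface_measure TYPE('p) \<Sigma> \<mu>"
    and u: "u \<in> U"
    and e: "norm e = 1"
    and coord3: "\<And>h. tangent_coord u 3 h = m3 * (e \<bullet> h)"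
    and coord4: "\<And>h. tangent_coord u 4 h = m4 * (e \<bullet> h)"
    and \<beta>: "3 / 2 \<le> \<beta>" "m3 = 0 \<or> 2 \<le> \<beta>" "m4 = 0 \<or> 3 \<le> \<beta>"
    and d: "3 / 2 * real (CARD('p) - 1) + \<beta> < real d"
  shows "((\<lambda>r. emeasure \<mu> (\<Sigma> \<inter> Metric_space.mcball UNIV \<rho> (\<phi> u) r) / ennreal (r ^ d))
           \<longlongrightarrow> \<infinity>) (at_right 0)"
proof -
  define x where "x = \<phi> u"
  define q where "q i v = engel_coords x (\<phi> (u + v) - \<phi> u) $ i" for i v
  obtain \<delta> C where \<delta>: "\<delta> > 0" "C \<ge> 0"
    and quadratic: "\<And>v i. norm v < \<delta> \<Longrightarrow> \<bar>q i v - tangent_coord u i v\<bar> \<le> C * (norm v)\<^sup>2"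
    and linear: "\<And>v i. norm v < \<delta> \<Longrightarrow> \<bar>q i v\<bar> \<le> C * norm v"
    unfolding q_def tangent_coord_def x_def
    by (rule quadratic_remainder[OF u, of "\<phi> u"]) blast
  define M where "M = C + \<bar>m3\<bar> + \<bar>m4\<bar>"
  show ?thesis
  proof (rule density_infinite_if_slab[OF \<rho> \<mu> u e _ _ d \<delta>(1), where M = M])
    fix c r :: real and v :: "real ^ 'p::{finite, wellorder}" and i
    assume c: "0 < c" "c \<le> 1" and r: "0 < r" "r \<le> 1" and v: "norm v < \<delta>"
      "norm v \<le> c * r powr (3 / 2)" "\<bar>e \<bullet> v\<bar> \<le> c * r powr \<beta>"
    have v1: "norm v \<le> c * r"
    proof -
      have "r powr (3 / 2) \<le> r powr 1" using r by (intro powr_mono') auto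
      then have "c * r powr (3 / 2) \<le> c * r" using c r by (intro mult_left_mono) auto
      with v(2) show ?thesis by linarith
    qed
    have v2: "(norm v)\<^sup>2 \<le> c * r ^ 3"
    proof -
      have "(norm v)\<^sup>2 \<le> (c * r powr (3 / 2))\<^sup>2" using v(2) by (intro power_mono) auto
      also have "\<dots> = c\<^sup>2 * r ^ 3"
        using r by (simp add: power_mult_distrib powr_power powr_numeral)
      also have "\<dots> \<le> c * r ^ 3"
        using c r by (intro mult_right_mono) (auto simp: power2_eq_square mult_left_le)
      finally show ?thesis .
    qed
    have slab: "\<bar>m * (e \<bullet> v)\<bar> \<le> \<bar>m\<bar> * (c * r ^ k)" if "m = 0 \<or> real k \<le> \<beta>" for m k
    proof (cases "m = 0")
      case False
      then have "r powr \<beta> \<le> r powr real k" using that r by (intro powr_mono') auto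
      then have "c * r powr \<beta> \<le> c * r ^ k" using c r by (simp add: powr_realpow)
      then have "\<bar>e \<bullet> v\<bar> \<le> c * r ^ k" using v(3) by linarith
      then show ?thesis by (simp add: abs_mult mult_left_mono)
    qed simp
    have horizontal: "\<bar>q i v\<bar> \<le> M * (c * r)" for i
    proof -
      have "C * norm v \<le> M * (c * r)"
        using v1 \<delta> c r by (intro mult_mono) (auto simp: M_def)
      then show ?thesis using linear[OF v(1), of i] by linarith
    qed
    have r32: "r ^ 3 \<le> r ^ 2" using r by (intro power_decreasing) auto
    have remainder: "C * (norm v)\<^sup>2 \<le> C * (c * r ^ 3)"
      using v2 \<delta> by (intro mult_left_mono) auto
    have "\<bar>q 3 v\<bar> \<le> \<bar>m3\<bar> * (c * r ^ 2) + C * (c * r ^ 3)"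
      using quadratic[OF v(1), of 3] slab[of m3 2] \<beta> remainder by (simp add: coord3)
    also have "\<dots> \<le> \<bar>m3\<bar> * (c * r ^ 2) + C * (c * r ^ 2)"
      using r32 c \<delta> by (intro add_left_mono mult_left_mono) auto
    also have "\<dots> \<le> M * (c * r ^ 2)" using c r by (simp add: M_def distrib_right)
    finally have q3: "\<bar>q 3 v\<bar> \<le> M * (c * r ^ 2)" .
    have "\<bar>q 4 v\<bar> \<le> \<bar>m4\<bar> * (c * r ^ 3) + C * (c * r ^ 3)"
      using quadratic[OF v(1), of 4] slab[of m4 3] \<beta> remainder by (simp add: coord4)
    also have "\<dots> \<le> M * (c * r ^ 3)" using c r by (simp add: M_def distrib_right)
    finally have q4: "\<bar>q 4 v\<bar> \<le> M * (c * r ^ 3)" .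
    have "\<forall>i. \<bar>q i v\<bar> \<le> M * c * r ^ engel_weight i"
      using horizontal q3 q4 by (simp add: forall_4 engel_weight_def mult.assoc)
    then show "\<bar>engel_coords (\<phi> u) (\<phi> (u + v) - \<phi> u) $ i\<bar> \<le> M * c * r ^ engel_weight i"
      by (simp add: q_def x_def)
  qed (use \<beta> in auto)
qed

text \<open>A slab that is thin in the direction in which \<open>\<theta>\<^sub>4\<close> varies, with \<open>\<alpha> = 2\<close>, \<open>\<beta> = 3\<close> is mapped into the box whatever the differential is:
  \<open>q\<^sub>3 = O(r\<^sup>2)\<close>, and the quadratic remainder of \<open>q\<^sub>4\<close> is \<open>O(r\<^sup>4)\<close>.\<close>

lemma density_infinite_above_top_weight:
  assumes \<rho>: "homogeneous_distance \<rho>"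
    and \<mu>: "riemannian_surface_measure TYPE('p) \<Sigma> \<mu>"
    and u: "u \<in> U"
    and d: "2 * CARD('p) + 1 < d"
  shows "((\<lambda>r. emeasure \<mu> (\<Sigma> \<inter> Metric_space.mcball UNIV \<rho> (\<phi> u) r) / ennreal (r ^ d))
           \<longlongrightarrow> \<infinity>) (at_right 0)"
proof -
  define x where "x = \<phi> u"
  define q where "q i v = engel_coords x (\<phi> (u + v) - \<phi> u) $ i" for i v
  obtain \<delta> C where \<delta>: "\<delta> > 0" "C \<ge> 0"
    and quadratic: "\<And>v i. norm v < \<delta> \<Longrightarrow> \<bar>q i v - tangent_coord u i v\<bar> \<le> C * (norm v)\<^sup>2"
    and linear: "\<And>v i. norm v < \<delta> \<Longrightarrow> \<bar>q i v\<bar> \<le> C * norm v"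
    unfolding q_def tangent_coord_def x_def
    by (rule quadratic_remainder[OF u, of "\<phi> u"]) blast
  obtain e m where e: "norm e = 1" and coord4: "\<And>h. tangent_coord u 4 h = m * (e \<bullet> h)"
    using linear_functional_unit_vector[OF linear_tangent_coord] by metis
  define M where "M = C + \<bar>m\<bar>"
  have "CARD('p) > 0" by simp
  then have exponent: "2 * real (CARD('p) - 1) + 3 < real d" using d by (simp add: of_nat_diff)
  show ?thesis
  proof (rule density_infinite_if_slab[OF \<rho> \<mu> u e _ _ exponent \<delta>(1), where M = M])
    fix c r :: real and v :: "real ^ 'p::{finite, wellorder}" and i
    assume c: "0 < c" "c \<le> 1" and r: "0 < r" "r \<le> 1" and v: "norm v < \<delta>"
      "norm v \<le> c * r powr 2" "\<bar>e \<bullet> v\<bar> \<le> c * r powr 3"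
    have v1: "norm v \<le> c * r\<^sup>2" and ev: "\<bar>e \<bullet> v\<bar> \<le> c * r ^ 3"
      using v r by (simp_all add: powr_numeral)
    have small: "\<bar>q i v\<bar> \<le> M * (c * r\<^sup>2)" for i
    proof -
      have "C * norm v \<le> M * (c * r\<^sup>2)"
        using v1 \<delta> c r by (intro mult_mono) (auto simp: M_def)
      then show ?thesis using linear[OF v(1), of i] by linarith
    qed
    have "r\<^sup>2 \<le> r" using r by (simp add: power2_eq_square mult_left_le)
    then have "M * (c * r\<^sup>2) \<le> M * (c * r)"
      using \<delta> c by (intro mult_left_mono) (auto simp: M_def)
    then have horizontal: "\<bar>q i v\<bar> \<le> M * (c * r)" for i using small[of i] by linarith
    have "(norm v)\<^sup>2 \<le> c * r ^ 3"
    proof -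
      have "(norm v)\<^sup>2 \<le> (c * r\<^sup>2)\<^sup>2" using v1 by (intro power_mono) auto
      also have "\<dots> = (c * c) * (r ^ 3 * r)" by (simp add: power2_eq_square power3_eq_cube)
      also have "\<dots> \<le> c * r ^ 3"
        using c r by (intro mult_mono) (auto simp: mult_left_le)
      finally show ?thesis .
    qed
    then have "C * (norm v)\<^sup>2 \<le> C * (c * r ^ 3)" using \<delta> by (intro mult_left_mono) auto
    moreover have "\<bar>m * (e \<bullet> v)\<bar> \<le> \<bar>m\<bar> * (c * r ^ 3)"
      using ev by (simp add: abs_mult mult_left_mono)
    ultimately have "\<bar>q 4 v\<bar> \<le> C * (c * r ^ 3) + \<bar>m\<bar> * (c * r ^ 3)"
      using quadratic[OF v(1), of 4] by (simp add: coord4)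
    then have q4: "\<bar>q 4 v\<bar> \<le> M * (c * r ^ 3)" by (simp add: M_def distrib_right)
    have "\<forall>i. \<bar>q i v\<bar> \<le> M * c * r ^ engel_weight i"
      using horizontal small[of 3] q4 by (simp add: forall_4 engel_weight_def mult.assoc)
    then show "\<bar>engel_coords (\<phi> u) (\<phi> (u + v) - \<phi> u) $ i\<bar> \<le> M * c * r ^ engel_weight i"
      by (simp add: q_def x_def)
  qed auto
qed

text \<open>When no tangent vector has an \<open>X\<^sub>4\<close>-component, the chart satisfies the contact equation
  \<open>dx\<^sub>4 - x\<^sub>1 dx\<^sub>3 + x\<^sub>1\<^sup>2/2 dx\<^sub>2 = 0\<close>, which by left invariance reads
  \<open>dq\<^sub>4 = q\<^sub>1 (dq\<^sub>3 - q\<^sub>1/2 dq\<^sub>2)\<close>. Now \<open>q\<^sub>1 = O(\<bar>v\<bar>)\<close>, and \<open>dq\<^sub>3 = O(\<bar>v\<bar>)\<close> because it is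
  Lipschitz and vanishes at \<open>v = 0\<close>. So \<open>dq\<^sub>4 = O(\<bar>v\<bar>\<^sup>2)\<close>, one order better than the chart's regularity
  gives.\<close>

lemma cubic_remainder:
  assumes u: "u \<in> U"
    and coord3: "\<And>h. tangent_coord u 3 h = 0"
    and coord4: "\<And>w h. w \<in> U \<Longrightarrow> tangent_coord w 4 h = 0"
  obtains \<delta> C where "\<delta> > 0" "C \<ge> 0"
    "\<And>v. norm v < \<delta> \<Longrightarrow> \<bar>engel_coords (\<phi> u) (\<phi> (u + v) - \<phi> u) $ 4\<bar> \<le> C * norm v ^ 3"
proof -
  define x where "x = \<phi> u"
  define q where "q i v = engel_coords x (\<phi> (u + v) - \<phi> u) $ i" for i v
  define \<omega> where "\<omega> i v h = engel_coords x (\<phi>' (u + v) h) $ i" for i v h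
  obtain \<delta>0 C where \<delta>0: "\<delta>0 > 0" "C \<ge> 0" "ball u \<delta>0 \<subseteq> U"
    and change: "\<And>v h i. norm v < \<delta>0 \<Longrightarrow> \<bar>\<omega> i v h - tangent_coord u i h\<bar> \<le> C * norm v * norm h"
    and linear: "\<And>v i. norm v < \<delta>0 \<Longrightarrow> \<bar>q i v\<bar> \<le> C * norm v"
    and size: "\<And>h i. \<bar>tangent_coord u i h\<bar> \<le> C * norm h"
    unfolding q_def tangent_coord_def x_def \<omega>_def
    by (rule quadratic_remainder[OF u, of "\<phi> u"]) blast
  define \<delta> where "\<delta> = min 1 \<delta>0"
  have \<delta>: "\<delta> > 0" "\<delta> \<le> 1" "\<delta> \<le> \<delta>0" using \<delta>0 by (auto simp: \<delta>_def)
  have inU: "u + v \<in> U" if "norm v < \<delta>" for v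
  proof -
    have "u + v \<in> ball u \<delta>0" using that \<delta> by (simp add: dist_norm)
    then show ?thesis using \<delta>0(3) by blast
  qed
  have deriv: "(q 4 has_derivative \<omega> 4 v) (at v)" if "norm v < \<delta>" for v
  proof -
    have "((\<lambda>v. u + v) has_derivative (\<lambda>h. h)) (at v)" by (auto intro!: derivative_eq_intros)
    from has_derivative_compose[OF this has_derivative[OF inU[OF that]]]
    have "((\<lambda>v. \<phi> (u + v) - \<phi> u) has_derivative \<phi>' (u + v)) (at v)"
      by (auto intro!: derivative_eq_intros)
    from bounded_linear.has_derivative[OF bounded_linear_engel_coords_nth this]
    show ?thesis unfolding q_def \<omega>_def .
  qed
  have contact: "\<omega> 4 v h = q 1 v * (\<omega> 3 v h - q 1 v / 2 * \<omega> 2 v h)" if "norm v < \<delta>" for v h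
    using coord4[OF inU[OF that], of h]
    by (simp add: tangent_coord_def \<omega>_def q_def x_def engel_coords_eq field_simps power2_eq_square)
  have bound: "\<bar>\<omega> 4 v h\<bar> \<le> (C\<^sup>2 + C ^ 3) * (norm v)\<^sup>2 * norm h" if v: "norm v < \<delta>" for v h
  proof -
    have v0: "norm v < \<delta>0" "norm v \<le> 1" using v \<delta> by auto
    have 3: "\<bar>\<omega> 3 v h\<bar> \<le> C * norm v * norm h"
      using change[OF v0(1), of 3 h] by (simp add: coord3)
    have "C * norm v * norm h \<le> C * norm h"
      using v0 \<delta>0 by (intro mult_right_mono) (auto simp: mult_left_le)
    then have 2: "\<bar>\<omega> 2 v h\<bar> \<le> 2 * (C * norm h)"
      using change[OF v0(1), of 2 h] size[of 2 h] by linarith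
    have "\<bar>q 1 v / 2 * \<omega> 2 v h\<bar> \<le> (C * norm v / 2) * (2 * (C * norm h))"
      unfolding abs_mult using linear[OF v0(1), of 1] 2 \<delta>0 by (intro mult_mono) auto
    then have "\<bar>\<omega> 3 v h - q 1 v / 2 * \<omega> 2 v h\<bar> \<le> C * norm v * norm h + C\<^sup>2 * norm v * norm h"
      using 3 by (simp add: power2_eq_square algebra_simps)
    then have "\<bar>\<omega> 4 v h\<bar> \<le> (C * norm v) * (C * norm v * norm h + C\<^sup>2 * norm v * norm h)"
      unfolding contact[OF v] abs_mult using linear[OF v0(1), of 1] \<delta>0 by (intro mult_mono) auto
    then show ?thesis by (simp add: algebra_simps power2_eq_square power3_eq_cube)
  qed
  show thesis
  proof (rule that[of \<delta> "C\<^sup>2 + C ^ 3"])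
    show "\<delta> > 0" "C\<^sup>2 + C ^ 3 \<ge> 0" using \<delta> \<delta>0 by auto
    fix v :: "real ^ 'p::{finite, wellorder}"
    assume v: "norm v < \<delta>"
    have "norm (q 4 v - q 4 0) \<le> (C\<^sup>2 + C ^ 3) * (norm v)\<^sup>2 * norm (v - 0)"
    proof (rule differentiable_bound[of "cball 0 (norm v)" _ "\<omega> 4"])
      fix w :: "real ^ 'p::{finite, wellorder}"
      assume "w \<in> cball 0 (norm v)"
      then have w: "norm w \<le> norm v" by simp
      then have w': "norm w < \<delta>" using v by simp
      show "(q 4 has_derivative \<omega> 4 w) (at w within cball 0 (norm v))"
        using deriv[OF w'] by (rule has_derivative_at_withinI)
      show "onorm (\<omega> 4 w) \<le> (C\<^sup>2 + C ^ 3) * (norm v)\<^sup>2"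
      proof (rule onorm_le)
        fix h :: "real ^ 'p::{finite, wellorder}"
        have "(C\<^sup>2 + C ^ 3) * (norm w)\<^sup>2 * norm h \<le> (C\<^sup>2 + C ^ 3) * (norm v)\<^sup>2 * norm h"
          using w \<delta>0 by (intro mult_right_mono mult_left_mono power_mono) auto
        then show "norm (\<omega> 4 w h) \<le> (C\<^sup>2 + C ^ 3) * (norm v)\<^sup>2 * norm h"
          using bound[OF w', of h] by simp
      qed
    qed auto
    moreover have "q 4 0 = 0" by (simp add: q_def linear_0[OF linear_engel_coords_nth])
    ultimately show "\<bar>engel_coords (\<phi> u) (\<phi> (u + v) - \<phi> u) $ 4\<bar> \<le> (C\<^sup>2 + C ^ 3) * norm v ^ 3"
      by (simp add: q_def x_def power2_eq_square power3_eq_cube mult.assoc)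
  qed
qed

text \<open>The slab is a ball of radius \<open>c r\<close>: its exponents are \<open>\<alpha> = \<beta> = 1\<close>, and \<open>e\<close> is an arbitrary unit vector.\<close>

lemma density_infinite_horizontal:
  assumes \<rho>: "homogeneous_distance \<rho>"
    and \<mu>: "riemannian_surface_measure TYPE('p) \<Sigma> \<mu>"
    and u: "u \<in> U"
    and coord3: "\<And>h. tangent_coord u 3 h = 0"
    and coord4: "\<And>w h. w \<in> U \<Longrightarrow> tangent_coord w 4 h = 0"
    and d: "CARD('p) < d"
  shows "((\<lambda>r. emeasure \<mu> (\<Sigma> \<inter> Metric_space.mcball UNIV \<rho> (\<phi> u) r) / ennreal (r ^ d))
           \<longlongrightarrow> \<infinity>) (at_right 0)"
proof -
  define x where "x = \<phi> u"
  define q where "q i v = engel_coords x (\<phi> (u + v) - \<phi> u) $ i" for i v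
  obtain \<delta>1 C where \<delta>1: "\<delta>1 > 0" "C \<ge> 0"
    and quadratic: "\<And>v i. norm v < \<delta>1 \<Longrightarrow> \<bar>q i v - tangent_coord u i v\<bar> \<le> C * (norm v)\<^sup>2"
    and linear: "\<And>v i. norm v < \<delta>1 \<Longrightarrow> \<bar>q i v\<bar> \<le> C * norm v"
    unfolding q_def tangent_coord_def x_def
    by (rule quadratic_remainder[OF u, of "\<phi> u"]) blast
  obtain \<delta>2 C' where \<delta>2: "\<delta>2 > 0" "C' \<ge> 0"
    and cubic: "\<And>v. norm v < \<delta>2 \<Longrightarrow> \<bar>q 4 v\<bar> \<le> C' * norm v ^ 3"
    unfolding q_def x_def by (rule cubic_remainder[OF u coord3 coord4]) blast+
  obtain e :: "real ^ 'p::{finite, wellorder}" where e: "norm e = 1"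
    using vector_choose_size[of 1] by auto
  define M where "M = C + C'"
  define \<delta> where "\<delta> = min \<delta>1 \<delta>2"
  have \<delta>: "\<delta> > 0" using \<delta>1 \<delta>2 by (simp add: \<delta>_def)
  have "CARD('p) > 0" by simp
  then have exponent: "1 * real (CARD('p) - 1) + 1 < real d" using d by (simp add: of_nat_diff)
  show ?thesis
  proof (rule density_infinite_if_slab[OF \<rho> \<mu> u e _ _ exponent \<delta>, where M = M])
    fix c r :: real and v :: "real ^ 'p::{finite, wellorder}" and i
    assume c: "0 < c" "c \<le> 1" and r: "0 < r" "r \<le> 1" and v: "norm v < \<delta>"
      "norm v \<le> c * r powr 1"
    have v1: "norm v \<le> c * r" using v(2) r by simp
    have v0: "norm v < \<delta>1" "norm v < \<delta>2" using v(1) by (auto simp: \<delta>_def)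
    have power: "norm v ^ k \<le> c * r ^ k" if "k > 0" for k
    proof -
      have "norm v ^ k \<le> (c * r) ^ k" using v1 by (intro power_mono) auto
      also have "\<dots> = c ^ k * r ^ k" by (rule power_mult_distrib)
      also have "\<dots> \<le> c ^ 1 * r ^ k" using c r that by (intro mult_right_mono power_decreasing) auto
      finally show ?thesis by simp
    qed
    have weaken: "A * norm v ^ k \<le> M * (c * r ^ k)" if "0 \<le> A" "A \<le> M" "k > 0" for A k
      using that power[of k] \<delta>1 by (intro mult_mono) auto
    have M: "C \<le> M" "C' \<le> M" using \<delta>1 \<delta>2 by (auto simp: M_def)
    have "\<bar>q i v\<bar> \<le> M * (c * r)" for i
      using linear[OF v0(1), of i] weaken[of C 1] M \<delta>1 by simp
    moreover have "\<bar>q 3 v\<bar> \<le> M * (c * r\<^sup>2)"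
      using quadratic[OF v0(1), of 3] weaken[of C 2] M \<delta>1 by (simp add: coord3)
    moreover have "\<bar>q 4 v\<bar> \<le> M * (c * r ^ 3)"
      using cubic[OF v0(2)] weaken[of C' 3] M \<delta>2 by simp
    ultimately have "\<forall>i. \<bar>q i v\<bar> \<le> M * c * r ^ engel_weight i"
      by (simp add: forall_4 engel_weight_def mult.assoc)
    then show "\<bar>engel_coords (\<phi> u) (\<phi> (u + v) - \<phi> u) $ i\<bar> \<le> M * c * r ^ engel_weight i"
      by (simp add: q_def x_def)
  qed auto
qed

end

section \<open>Infinite density at points of low degree\<close>

theorem theorem1:
  fixes \<rho> :: "real ^ 4 \<Rightarrow> real ^ 4 \<Rightarrow> real"
    and \<Sigma> :: "(real ^ 4) set"
    and \<mu> :: "(real ^ 4) measure"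
    and d :: nat
    and x :: "real ^ 4"
  assumes "CARD('p::{finite, wellorder}) \<in> {1, 2}"
    and "homogeneous_distance \<rho>"
    and "c11_submanifold TYPE('p) \<Sigma>"
    and "riemannian_surface_measure TYPE('p) \<Sigma> \<mu>"
    and "submanifold_degree TYPE('p) \<Sigma> = d"
    and "x \<in> \<Sigma>"
    and "pointwise_degree TYPE('p) \<Sigma> x < d"
  shows "((\<lambda>r. emeasure \<mu> (\<Sigma> \<inter> Metric_space.mcball UNIV \<rho> x r) / ennreal (r ^ d))
           \<longlongrightarrow> \<infinity>) (at_right 0)"
proof -
  note \<rho> = assms(2) and \<mu> = assms(4)
  obtain U :: "(real ^ 'p::{finite, wellorder}) set" and \<phi> u
    where chart: "local_parametrization \<Sigma> U \<phi>" and u: "u \<in> U" and x: "x = \<phi> u"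
    using assms(3,6) unfolding c11_submanifold_def by blast
  obtain \<phi>' where "\<forall>u\<in>U. (\<phi> has_derivative blinfun_apply (\<phi>' u)) (at u) \<and> inj (blinfun_apply (\<phi>' u))"
      "\<forall>u\<in>U. \<exists>e>0. \<exists>L. lipschitz_on L (U \<inter> ball u e) \<phi>'"
    using chart unfolding local_parametrization_def by blast
  then interpret c11_chart \<Sigma> U \<phi> \<phi>'
    using chart by unfold_locales auto
  note degree = assms(7)[unfolded x]
  have weights: "engel_weight 1 = 1" "engel_weight 2 = 1" "engel_weight 3 = 2" "engel_weight 4 = 3"
    by (simp_all add: engel_weight_def)
  have weight_pos: "1 \<le> engel_weight i" for i by (simp add: engel_weight_def)
  \<comment> \<open>excludes that \<open>d\<close> is at most \<open>p\<close>, as then all minors at \<open>x\<close> would vanish\<close>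
  have immersion: "\<not> (\<forall>i h. tangent_coord u i h = 0)"
  proof
    assume "\<forall>i h. tangent_coord u i h = 0"
    then have "axis undefined 1 = (0 :: real ^ 'p::{finite, wellorder})"
      by (intro tangent_coords_eq_0_imp[OF u]) blast
    then show False by simp
  qed
  obtain e3 m3 where e3: "norm e3 = 1" "\<And>h. tangent_coord u 3 h = m3 * (e3 \<bullet> h)"
    using linear_functional_unit_vector[OF linear_tangent_coord] by metis
  obtain e4 m4 where e4: "norm e4 = 1" "\<And>h. tangent_coord u 4 h = m4 * (e4 \<bullet> h)"
    using linear_functional_unit_vector[OF linear_tangent_coord] by metis
  show ?thesis
    unfolding x
  proof (cases "CARD('p) = 1")
    case True
    note zero = tangent_coord_eq_0_curve[OF True u]
    consider "d \<le> 1" | "d = 2" | "d = 3" | "d \<ge> 4" by linarith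
    then show "((\<lambda>r. emeasure \<mu> (\<Sigma> \<inter> Metric_space.mcball UNIV \<rho> (\<phi> u) r) / ennreal (r ^ d))
        \<longlongrightarrow> \<infinity>) (at_right 0)"
    proof cases
      case 1
      have "pointwise_degree TYPE('p) \<Sigma> (\<phi> u) < engel_weight i" for i
        using degree 1 weight_pos[of i] by linarith
      then have False using immersion zero by blast
      then show ?thesis ..
    next
      case 2
      then have "tangent_coord u 3 h = 0 * (e3 \<bullet> h)" "tangent_coord u 4 h = 0 * (e3 \<bullet> h)" for h
        using degree zero[of 3 h] zero[of 4 h] by (simp_all add: weights)
      then show ?thesis
        using True 2 by (intro density_infinite_rank_one[OF \<rho> \<mu> u e3(1), of 0 0 "3 / 2"]) auto
    next
      case 3
      then have "tangent_coord u 4 h = 0 * (e3 \<bullet> h)" for h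
        using degree zero[of 4 h] by (simp add: weights)
      then show ?thesis
        using True 3 by (intro density_infinite_rank_one[OF \<rho> \<mu> u e3, of 0 2]) auto
    next
      case 4
      then show ?thesis using True by (intro density_infinite_above_top_weight[OF \<rho> \<mu> u]) simp
    qed
  next
    case False
    then have card: "CARD('p) = 2" using assms(1) by simp
    note zero = tangent_coord_eq_0_surface[OF card u]
    consider "d \<le> 2" | "d = 3" | "d = 4" | "d = 5" | "d \<ge> 6" by linarith
    then show "((\<lambda>r. emeasure \<mu> (\<Sigma> \<inter> Metric_space.mcball UNIV \<rho> (\<phi> u) r) / ennreal (r ^ d))
        \<longlongrightarrow> \<infinity>) (at_right 0)"
    proof cases
      case 1
      have "pointwise_degree TYPE('p) \<Sigma> (\<phi> u) < engel_weight i + engel_weight j" for i j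
        using degree 1 weight_pos[of i] weight_pos[of j] by linarith
      then have False using immersion zero by blast
      then show ?thesis ..
    next
      case 2
      have "pointwise_degree TYPE('p) \<Sigma> (\<phi> u) < engel_weight 3 + engel_weight j" for j
        using degree 2 weight_pos[of j] by (simp add: weights)
      then have coord3: "tangent_coord u 3 h = 0" for h by (rule zero)
      \<comment> \<open>at the other points of the chart only the degree of the whole surface is available\<close>
      have coord4: "tangent_coord w 4 h = 0" if w: "w \<in> U" for w h
      proof (rule tangent_coord_eq_0_surface[OF card w])
        fix j
        have "pointwise_degree TYPE('p) \<Sigma> (\<phi> w) \<le> 3"
          using pointwise_degree_le_submanifold_degree[OF parametrization_in[OF w], where 'p = 'p]
            assms(5) 2 by simp
        then show "pointwise_degree TYPE('p) \<Sigma> (\<phi> w) < engel_weight 4 + engel_weight j"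
          using weight_pos[of j] by (simp add: weights)
      qed
      show ?thesis
        using card 2 by (intro density_infinite_horizontal[OF \<rho> \<mu> u coord3 coord4]) simp_all
    next
      case 3
      have "pointwise_degree TYPE('p) \<Sigma> (\<phi> u) < engel_weight 4 + engel_weight j" for j
        using degree 3 weight_pos[of j] by (simp add: weights)
      then have "tangent_coord u 4 h = 0 * (e3 \<bullet> h)" for h using zero by simp
      then show ?thesis
        using card 3 by (intro density_infinite_rank_one[OF \<rho> \<mu> u e3, of 0 2]) auto
    next
      case 4
      show ?thesis
      proof (cases "\<forall>h. tangent_coord u 4 h = 0")
        case True
        then have "tangent_coord u 4 h = 0 * (e3 \<bullet> h)" for h by simp
        then show ?thesis
          using card 4 by (intro density_infinite_rank_one[OF \<rho> \<mu> u e3, of 0 2]) auto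
      next
        case False
        then obtain k where k: "tangent_coord u 4 k \<noteq> 0" by blast
        have "pointwise_degree TYPE('p) \<Sigma> (\<phi> u) < engel_weight 3 + engel_weight 4"
          using degree 4 by (simp add: weights)
        note proportional = tangent_coords_proportional_surface[OF card u this]
        define l where "l = tangent_coord u 3 k / tangent_coord u 4 k"
        have "tangent_coord u 3 h = l * tangent_coord u 4 h" for h
          using proportional[of h k] k by (simp add: l_def field_simps)
        then have "tangent_coord u 3 h = l * m4 * (e4 \<bullet> h)" for h
          by (simp add: e4(2))
        then show ?thesis
          using card 4 by (intro density_infinite_rank_one[OF \<rho> \<mu> u e4(1) _ e4(2), of _ 3]) auto
      qed
    next
      case 5
      then show ?thesis using card by (intro density_infinite_above_top_weight[OF \<rho> \<mu> u]) simp
    qed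
  qed
qed

end
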